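(* Fix integers $n,k\ge1$. Then the following hold. (i) The matrix $\pi_{n,k}$ is triangular with positive diagonal entries when $\mathcal H_n$ is partially ordered by the existence of a surjective map of multigraphs (i.e. $\pi_{n,k}(g,h)\ne0$ only if some multigraph in $h$ surjects onto some multigraph in $g$, this relation is a partial order on $\mathcal H_n$, and $\pi_{n,k}(g,g)>0$). (ii) For $p\ge2$, the maps $\pi_{n,kp\to p}$ are surjective, are invertible for $p\ge2n$, and are compatible in the following sense: given positive integers $n,k_1,k_2$ and $p\ge2$, $$\pi_{n,k_1k_2p\to p}=\pi_{n,k_2p\to p}\circ\pi_{n,k_1k_2p\to k_2p}.$$ (iii) For each $n\ge 1$, the subspace $LC_n\subset\prod_{p\ge2}X_{n,p}$ of linearly consistent vectors $(A_{n,p}(h))_{h\in\mathcal H_n^{(p)},\,p\ge2}$ has dimension $|\mathcal H_n|$. (iv) If $\Lambda\in\mathfrak X_n$, then for any $p_0\ge2n$ the $|\mathcal H_n|$ components of $C_{n,p_0}(\Lambda)\in X_{n,p_0}$ determine the value of $\Lambda$ on $\sigma(\mathcal W_{\bf p}^n)=\{(g_1^\sigma,\dots,g_n^\sigma):g_i\in\mathcal W_{\bf p}\}$ for all $\sigma\in S_{[0,1]}$.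
   Context: $\mathcal W_{[0,1]}$ is the set of symmetric measurable functions $f:[0,1]^2\to[0,1]$; $S_{[0,1]}$ is the group of Lebesgue measure-preserving bijections of $[0,1]$, and $g^\sigma(x,y)=g(\sigma(x),\sigma(y))$. $\mathfrak X_n$ is the vector space of functionals $\Lambda:\mathcal W_{[0,1]}^n\to\mathbb R$ that are multilinear (extend to a multilinear functional on $(\operatorname{span}_{\mathbb R}\mathcal W_{[0,1]})^n$), symmetric (invariant under permuting the $n$ arguments), and $S_{[0,1]}$-invariant ($\Lambda(g_1^\sigma,\dots,g_n^\sigma)=\Lambda(g_1,\dots,g_n)$ for $\sigma\in S_{[0,1]}$). For $1\le a<b\le p$, $e^p_{(a,b)}=e^p_{(b,a)}$ is the indicator function of $\left(\frac{a-1}p,\frac ap\right]\times\left(\frac{b-1}p,\frac bp\right]$ plus that of $\left(\frac{b-1}p,\frac bp\right]\times\left(\frac{a-1}p,\frac ap\right]$; $E_p=\{e^p_{(a,b)}:1\le a<b\le p\}$; $\mathcal W_p=\mathcal W_{[0,1]}\cap\operatorname{span}_{\mathbb R}E_p$; $\mathcal W_{\bf p}=\bigcup_{p\ge1}\mathcal W_p$. For $x=(e^p_{(a_l,b_l)})_{l=1}^n\in E_p^n$, $\Gamma_{n,p}(x)$ is the multigraph with vertex set $\{1,\dots,p\}$ and $n$ edges, the $l$th joining $a_l$ and $b_l$. Multigraphs are finite, undirected, without loops, possibly with multiple edges. A map of multigraphs $H\to G$ is a pair of maps $V(H)\to V(G)$, $E(H)\to E(G)$ compatible with endpoints; it is surjective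 if both maps are. $\mathcal H_n$ is the set of isomorphism classes of multigraphs with $n$ edges and no isolated vertices; $\mathcal H_n^{(p)}$ is the set of isomorphism classes of multigraphs with $n$ edges and $p$ vertices (isolated vertices allowed). A tilde ($\widetilde h$, $\widetilde H$) denotes removing all isolated vertices. $X_{n,p}=\mathbb R^{\mathcal H_n^{(p)}}$. For $\Lambda\in\mathfrak X_n$, $p\ge2$, $C_{n,p}(\Lambda)\in X_{n,p}$ is defined by $C_{n,p}(\Lambda)(h)=\Lambda(x)$ for any $x\in E_p^n$ with $\Gamma_{n,p}(x)$ in the class $h$ (independent of the choice). The matrix $\pi_{n,k}\in\mathbb Z_{\ge0}^{\mathcal H_n\times\mathcal H_n}$: for $g,h\in\mathcal H_n$, choose any $p\ge2$ and $x=(e^p_{(a_l,b_l)})_{l=1}^n\in E_p^n$ such that $\widetilde{\Gamma_{n,p}(x)}$ is in the class $g$; then $\pi_{n,k}(g,h)$ is the number of tuples $(i_l,j_l)_{l=1}^n\in\{1,\dots,k\}^{2n}$ such that the multigraph $\Gamma_{n,kp}\big((e^{kp}_{(k(a_l-1)+i_l,\,k(b_l-1)+j_l)})_{l=1}^n\big)$, after removing isolated vertices, is in the class $h$ (this number is independent of the choices of $p$ and $x$). It satisfies $C_{n,p}(\Lambda)(g)=\sum_{h\in\mathcal H_n^{(kp)}}\pi_{n,k}(\widetilde g,\widetilde h)C_{n,kp}(\Lambda)(h)$ for all $\Lambda\in\mathfrak X_n$, $p\ge2$, $g\in\mathcal H_n^{(p)}$. The consistency map $\pi_{n,kp\to p}:X_{n,kp}\to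 X_{n,p}$ is $(\pi_{n,kp\to p}A)(g)=\sum_{h\in\mathcal H_n^{(kp)}}\pi_{n,k}(\widetilde g,\widetilde h)A(h)$. A vector $(A_{n,p})_{p\ge2}\in\prod_{p\ge2}X_{n,p}$ is linearly consistent if $A_{n,p}=\pi_{n,kp\to p}(A_{n,kp})$ for all $p\ge2$, $k\ge1$. *)

theory Defs
  imports "HOL-Analysis.Analysis" "HOL-Library.Function_Algebras"
begin

instantiation "fun" :: (type, real_vector) real_vector
begin

definition scaleR_fun :: "real \<Rightarrow> ('a \<Rightarrow> 'b) \<Rightarrow> 'a \<Rightarrow> 'b"
  where "scaleR_fun c f = (\<lambda>x. c *\<^sub>R f x)"

instance
  by standard (auto simp: scaleR_fun_def fun_eq_iff scaleR_add_right scaleR_add_left)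

end

section \<open>Multigraphs\<close>

record ('v, 'e) multigraph =
  verts :: "'v set"
  edges :: "'e set"
  ends :: "'e \<Rightarrow> 'v set"

text \<open>Loops are excluded by requiring exactly two endpoints. The values of \<^term>\<open>ends\<close>
  off the edge set are irrelevant and are ignored by all notions below.\<close>

definition is_multigraph :: "('v, 'e) multigraph \<Rightarrow> bool" where
  "is_multigraph G \<longleftrightarrow> finite (verts G) \<and> finite (edges G) \<and>
     (\<forall>e\<in>edges G. ends G e \<subseteq> verts G \<and> card (ends G e) = 2)"

definition multigraph_map ::
  "('v \<Rightarrow> 'w) \<Rightarrow> ('e \<Rightarrow> 'f) \<Rightarrow> ('v, 'e) multigraph \<Rightarrow> ('w, 'f) multigraph \<Rightarrow> bool" where
  "multigraph_map \<phi> \<psi> H G \<longleftrightarrow> \<phi> ` verts H \<subseteq> verts G \<and> \<psi> ` edges H \<subseteq> edges G \<and>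
     (\<forall>e\<in>edges H. ends G (\<psi> e) = \<phi> ` ends H e)"

definition surjects_onto :: "('v, 'e) multigraph \<Rightarrow> ('w, 'f) multigraph \<Rightarrow> bool" where
  "surjects_onto H G \<longleftrightarrow>
     (\<exists>\<phi> \<psi>. multigraph_map \<phi> \<psi> H G \<and> \<phi> ` verts H = verts G \<and> \<psi> ` edges H = edges G)"

definition isomorphic :: "('v, 'e) multigraph \<Rightarrow> ('w, 'f) multigraph \<Rightarrow> bool" where
  "isomorphic H G \<longleftrightarrow>
     (\<exists>\<phi> \<psi>. multigraph_map \<phi> \<psi> H G \<and>
        bij_betw \<phi> (verts H) (verts G) \<and> bij_betw \<psi> (edges H) (edges G))"

definition remove_isolated :: "('v, 'e) multigraph \<Rightarrow> ('v, 'e) multigraph" where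
  "remove_isolated G = G\<lparr>verts := {v \<in> verts G. \<exists>e\<in>edges G. v \<in> ends G e}\<rparr>"

definition no_isolated :: "('v, 'e) multigraph \<Rightarrow> bool" where
  "no_isolated G \<longleftrightarrow> (\<forall>v\<in>verts G. \<exists>e\<in>edges G. v \<in> ends G e)"

text \<open>Every finite multigraph has a copy with vertices and edges in \<^typ>\<open>nat\<close>, so isomorphism
  classes are taken within that type.\<close>

type_synonym graph_class = "(nat, nat) multigraph set"

definition iso_class :: "(nat, nat) multigraph \<Rightarrow> graph_class" where
  "iso_class G = {G'. is_multigraph G' \<and> isomorphic G G'}"

definition Hn :: "nat \<Rightarrow> graph_class set" where
  "Hn n = {iso_class G |G. is_multigraph G \<and> card (edges G) = n \<and> no_isolated G}"

definition Hnp :: "nat \<Rightarrow> nat \<Rightarrow> graph_class set" where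
  "Hnp n p = {iso_class G |G. is_multigraph G \<and> card (edges G) = n \<and> card (verts G) = p}"

definition tilde :: "graph_class \<Rightarrow> graph_class" where
  "tilde h = iso_class (remove_isolated (SOME G. G \<in> h))"

definition surj_order :: "nat \<Rightarrow> (graph_class \<times> graph_class) set" where
  "surj_order n = {(g, h). g \<in> Hn n \<and> h \<in> Hn n \<and> (\<exists>H\<in>h. \<exists>G\<in>g. surjects_onto H G)}"

section \<open>Graphons and symmetric multilinear functionals\<close>

text \<open>Functions on the unit square are represented by functions on the plane that vanish outside
  it; they are actual functions, not classes modulo almost everywhere equality.\<close>

type_synonym kernel = "real \<times> real \<Rightarrow> real"

definition graphons :: "kernel set" where
  "graphons = {f. f \<in> borel_measurable (lebesgue_on ({0..1} \<times> {0..1})) \<and>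
     (\<forall>x y. f (x, y) = f (y, x)) \<and>
     (\<forall>z\<in>{0..1} \<times> {0..1}. f z \<in> {0..1}) \<and> (\<forall>z. z \<notin> {0..1} \<times> {0..1} \<longrightarrow> f z = 0)}"

text \<open>Measurability of the inverse map is automatic, so this is a group.\<close>

definition mp_bijections :: "(real \<Rightarrow> real) set" where
  "mp_bijections = {\<sigma>. bij_betw \<sigma> {0..1} {0..1} \<and>
     \<sigma> \<in> lebesgue_on {0..1} \<rightarrow>\<^sub>M lebesgue_on {0..1} \<and>
     distr (lebesgue_on {0..1}) (lebesgue_on {0..1}) \<sigma> = lebesgue_on {0..1}}"

definition act :: "(real \<Rightarrow> real) \<Rightarrow> kernel \<Rightarrow> kernel" where
  "act \<sigma> g = (\<lambda>(x, y). if x \<in> {0..1} \<and> y \<in> {0..1} then g (\<sigma> x, \<sigma> y) else 0)"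

text \<open>The \<open>n\<close>-tuples over \<open>V\<close> are the elements of \<^term>\<open>{1..n} \<rightarrow>\<^sub>E V\<close>.\<close>

definition act_tuple :: "nat \<Rightarrow> (real \<Rightarrow> real) \<Rightarrow> (nat \<Rightarrow> kernel) \<Rightarrow> nat \<Rightarrow> kernel" where
  "act_tuple n \<sigma> g = (\<lambda>l\<in>{1..n}. act \<sigma> (g l))"

definition multilinear_on :: "nat \<Rightarrow> kernel set \<Rightarrow> ((nat \<Rightarrow> kernel) \<Rightarrow> real) \<Rightarrow> bool" where
  "multilinear_on n V M \<longleftrightarrow>
     (\<forall>x\<in>{1..n} \<rightarrow>\<^sub>E V. \<forall>i\<in>{1..n}. \<forall>f\<in>V. \<forall>g\<in>V. \<forall>c d.
        M (x(i := c *\<^sub>R f + d *\<^sub>R g)) = c * M (x(i := f)) + d * M (x(i := g)))"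

definition functionals :: "nat \<Rightarrow> ((nat \<Rightarrow> kernel) \<Rightarrow> real) set" where
  "functionals n = {\<Lambda>.
     (\<exists>M. multilinear_on n (span graphons) M \<and> (\<forall>g\<in>{1..n} \<rightarrow>\<^sub>E graphons. M g = \<Lambda> g)) \<and>
     (\<forall>g\<in>{1..n} \<rightarrow>\<^sub>E graphons. \<forall>\<tau>. \<tau> permutes {1..n} \<longrightarrow> \<Lambda> (g \<circ> \<tau>) = \<Lambda> g) \<and>
     (\<forall>g\<in>{1..n} \<rightarrow>\<^sub>E graphons. \<forall>\<sigma>\<in>mp_bijections. \<Lambda> (act_tuple n \<sigma> g) = \<Lambda> g)}"

definition cell :: "nat \<Rightarrow> nat \<Rightarrow> real set" where
  "cell p a = {(real a - 1) / real p <.. real a / real p}"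

definition ep :: "nat \<Rightarrow> nat \<times> nat \<Rightarrow> kernel" where
  "ep p = (\<lambda>(a, b). \<lambda>z. indicat_real (cell p a \<times> cell p b) z + indicat_real (cell p b \<times> cell p a) z)"

definition Ep :: "nat \<Rightarrow> kernel set" where
  "Ep p = {ep p (a, b) |a b. 1 \<le> a \<and> a < b \<and> b \<le> p}"

definition Wp :: "nat \<Rightarrow> kernel set" where
  "Wp p = graphons \<inter> span (Ep p)"

definition Wstep :: "kernel set" where
  "Wstep = (\<Union>p\<in>{1..}. Wp p)"

section \<open>Index tuples and their multigraphs\<close>

text \<open>A tuple in \<open>(Ep p)\<^sup>n\<close> is given by its indices \<open>(a\<^sub>l, b\<^sub>l)\<close>; both orders of \<open>a\<^sub>l\<close> and \<open>b\<^sub>l\<close>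
  are allowed, as \<open>ep p (a, b) = ep p (b, a)\<close>.\<close>

definition index_tuples :: "nat \<Rightarrow> nat \<Rightarrow> (nat \<Rightarrow> nat \<times> nat) set" where
  "index_tuples n p = ({1..n} \<rightarrow>\<^sub>E {(a, b). a \<in> {1..p} \<and> b \<in> {1..p} \<and> a \<noteq> b})"

definition e_tuple :: "nat \<Rightarrow> nat \<Rightarrow> (nat \<Rightarrow> nat \<times> nat) \<Rightarrow> nat \<Rightarrow> kernel" where
  "e_tuple n p ab = (\<lambda>l\<in>{1..n}. ep p (ab l))"

definition \<Gamma> :: "nat \<Rightarrow> nat \<Rightarrow> (nat \<Rightarrow> nat \<times> nat) \<Rightarrow> (nat, nat) multigraph" where
  "\<Gamma> n p ab = \<lparr>verts = {1..p}, edges = {1..n}, ends = (\<lambda>l. {fst (ab l), snd (ab l)})\<rparr>"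

definition Xnp :: "nat \<Rightarrow> nat \<Rightarrow> (graph_class \<Rightarrow> real) set" where
  "Xnp n p = {A. \<forall>h. h \<notin> Hnp n p \<longrightarrow> A h = 0}"

text \<open>In the next definition and in that of \<open>\<pi>\<close>, the definite description expresses the
  independence of the choice.\<close>

definition Cnp :: "nat \<Rightarrow> nat \<Rightarrow> ((nat \<Rightarrow> kernel) \<Rightarrow> real) \<Rightarrow> graph_class \<Rightarrow> real" where
  "Cnp n p \<Lambda> h = (if h \<in> Hnp n p
     then THE v. \<forall>ab\<in>index_tuples n p. \<Gamma> n p ab \<in> h \<longrightarrow> v = \<Lambda> (e_tuple n p ab)
     else 0)"

definition refine :: "nat \<Rightarrow> (nat \<Rightarrow> nat \<times> nat) \<Rightarrow> (nat \<Rightarrow> nat \<times> nat) \<Rightarrow> nat \<Rightarrow> nat \<times> nat" where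
  "refine k ab ij =
     (\<lambda>l. (k * (fst (ab l) - 1) + fst (ij l), k * (snd (ab l) - 1) + snd (ij l)))"

definition \<pi> :: "nat \<Rightarrow> nat \<Rightarrow> graph_class \<Rightarrow> graph_class \<Rightarrow> nat" where
  "\<pi> n k g h = (THE m. \<forall>p\<ge>2. \<forall>ab\<in>index_tuples n p. remove_isolated (\<Gamma> n p ab) \<in> g \<longrightarrow>
     m = card {ij \<in> {1..n} \<rightarrow>\<^sub>E {1..k} \<times> {1..k}.
       remove_isolated (\<Gamma> n (k * p) (refine k ab ij)) \<in> h})"

text \<open>\<open>consistency n k p\<close> is the map \<open>\<pi>\<close> from \<^term>\<open>Xnp n (k * p)\<close> to \<^term>\<open>Xnp n p\<close>.\<close>

definition consistency ::
  "nat \<Rightarrow> nat \<Rightarrow> nat \<Rightarrow> (graph_class \<Rightarrow> real) \<Rightarrow> graph_class \<Rightarrow> real" where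
  "consistency n k p A = (\<lambda>g. if g \<in> Hnp n p
     then \<Sum>h\<in>Hnp n (k * p). real (\<pi> n k (tilde g) (tilde h)) * A h
     else 0)"

text \<open>Families indexed by \<open>p \<ge> 2\<close> are extended by zero to all \<open>p\<close>.\<close>

definition LC :: "nat \<Rightarrow> (nat \<Rightarrow> graph_class \<Rightarrow> real) set" where
  "LC n = {A. (\<forall>p\<ge>2. A p \<in> Xnp n p) \<and> (\<forall>p<2. A p = 0) \<and>
     (\<forall>p\<ge>2. \<forall>k\<ge>1. A p = consistency n k p (A (k * p)))}"

end

theory Submission
  imports Defs
begin

text \<open>
  Writing \<open>cl ab\<close> for the class of the multigraph of an index tuple \<open>ab\<close>, the consistency map becomes
  \<open>(\<pi> A) (cl ab) = (\<Sum>ij. A (cl (refine k ab ij)))\<close>, a sum over all ways of splitting the cells. In this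
  form compatibility is the base \<open>k\<^sub>1\<close> expansion of a position in \<open>{1..k\<^sub>1 k\<^sub>2}\<close>, and the identity relating
  \<open>C\<^sub>n\<^sub>,\<^sub>p(\<Lambda>)\<close> and \<open>C\<^sub>n\<^sub>,\<^sub>k\<^sub>p(\<Lambda>)\<close> is multilinear expansion of \<open>e\<^sup>p\<close> into the \<open>e\<^sup>k\<^sup>p\<close>.

  Collapsing the split cells is a surjection of multigraphs, so a nonzero off-diagonal entry of the
  matrix strictly increases the number of vertices. Hence the linear systems are solved by back
  substitution, starting from the classes with the most vertices. For \<open>p \<ge> 2n\<close> every class without isolated
  vertices occurs, so the maps are invertible there, and a consistent family is determined by, and
  can be built from, its component at \<open>2n\<close>. Finally, step functions on different grids have a common
  refinement to a grid \<open>k p\<^sub>0\<close>, where \<open>\<Lambda>\<close> is read off from its values on cell indicators.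
\<close>

section \<open>Multigraphs up to isolated vertices\<close>

text \<open>\<open>\<pi>\<close> and \<open>Cnp\<close> are definite descriptions, so nothing can be
  computed from them before independence of the choice is proved; much of the work goes there. For
  \<open>\<pi>\<close>, an isomorphism of two graphs without their isolated vertices must carry the
  splittings of one tuple bijectively to those of the other; the obstacle is that tuples list
  endpoints in an order that isomorphisms ignore. For \<open>Cnp\<close>, a relabelling of edges is
  absorbed by symmetry of the functional, and a relabelling of vertices by an explicit
  measure-preserving bijection that translates cells of the interval. The bound 2n is the largest
  number of vertices that n edges can touch.\<close>

definition spanned_verts :: "('v, 'e) multigraph \<Rightarrow> 'v set" where
  "spanned_verts G = (\<Union>e\<in>edges G. ends G e)"

lemma isomorphic_refl: "isomorphic G G"
  unfolding isomorphic_def multigraph_map_def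
  by (intro exI[of _ id]) auto

text \<open>The inverse bijections work: \<open>is_multigraph H\<close> places the endpoints of each
  edge in \<open>verts H\<close>, the set on which \<open>inv_into\<close> undoes
  \<open>\<phi>\<close>.\<close>

lemma isomorphic_sym:
  assumes "is_multigraph H" "isomorphic H G"
  shows "isomorphic G H"
proof -
  obtain \<phi> \<psi> where m: "multigraph_map \<phi> \<psi> H G"
    and \<phi>: "bij_betw \<phi> (verts H) (verts G)" and \<psi>: "bij_betw \<psi> (edges H) (edges G)"
    using assms unfolding isomorphic_def by blast
  let ?\<phi> = "inv_into (verts H) \<phi>" and ?\<psi> = "inv_into (edges H) \<psi>"
  have \<phi>': "bij_betw ?\<phi> (verts G) (verts H)" and \<psi>': "bij_betw ?\<psi> (edges G) (edges H)"
    using \<phi> \<psi> by (auto intro: bij_betw_inv_into)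
  have "ends H (?\<psi> e) = ?\<phi> ` ends G e" if e: "e \<in> edges G" for e
  proof -
    let ?d = "?\<psi> e"
    have d: "?d \<in> edges H" "\<psi> ?d = e"
      using e \<psi> \<psi>' by (auto simp: bij_betw_inv_into_right dest: bij_betwE)
    have "ends H ?d \<subseteq> verts H" using assms(1) d by (auto simp: is_multigraph_def)
    then have "?\<phi> ` \<phi> ` ends H ?d = ends H ?d"
      using \<phi> by (simp add: bij_betw_def inv_into_image_cancel)
    moreover have "ends G e = \<phi> ` ends H ?d" using m d by (auto simp: multigraph_map_def)
    ultimately show ?thesis by simp
  qed
  then have "multigraph_map ?\<phi> ?\<psi> G H"
    using \<phi>' \<psi>' by (auto simp: multigraph_map_def bij_betw_def)
  with \<phi>' \<psi>' show ?thesis unfolding isomorphic_def by blast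
qed

lemma multigraph_map_comp:
  assumes "multigraph_map \<phi> \<psi> H G" "multigraph_map \<phi>' \<psi>' G F"
  shows "multigraph_map (\<phi>' \<circ> \<phi>) (\<psi>' \<circ> \<psi>) H F"
  using assms unfolding multigraph_map_def by (auto simp: image_comp image_subset_iff)

lemma isomorphic_trans:
  assumes "isomorphic H G" "isomorphic G F"
  shows "isomorphic H F"
  using assms unfolding isomorphic_def by (meson bij_betw_trans multigraph_map_comp)

lemma surjects_onto_trans:
  assumes "surjects_onto H G" "surjects_onto G F"
  shows "surjects_onto H F"
proof -
  obtain \<phi> \<psi> where 1: "multigraph_map \<phi> \<psi> H G" "\<phi> ` verts H = verts G" "\<psi> ` edges H = edges G"
    using assms(1) unfolding surjects_onto_def by blast
  obtain \<phi>' \<psi>' where 2: "multigraph_map \<phi>' \<psi>' G F" "\<phi>' ` verts G = verts F" "\<psi>' ` edges G = edges F"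
    using assms(2) unfolding surjects_onto_def by blast
  have "(\<phi>' \<circ> \<phi>) ` verts H = verts F" "(\<psi>' \<circ> \<psi>) ` edges H = edges F"
    using 1(2,3) 2(2,3) by (simp_all only: image_comp[symmetric])
  with multigraph_map_comp[OF 1(1) 2(1)] show ?thesis unfolding surjects_onto_def by blast
qed

lemma isomorphic_surjects: "isomorphic H G \<Longrightarrow> surjects_onto H G"
  unfolding isomorphic_def surjects_onto_def bij_betw_def by blast

lemma isomorphic_card:
  assumes "isomorphic H G"
  shows "card (verts H) = card (verts G)" "card (edges H) = card (edges G)"
  using assms unfolding isomorphic_def by (auto dest: bij_betw_same_card)

lemma surjects_onto_card:
  assumes "is_multigraph H" "surjects_onto H G"
  shows "card (verts G) \<le> card (verts H)"
  using assms unfolding surjects_onto_def is_multigraph_def by (metis card_image_le)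

text \<open>A surjection between finite sets of equal size is injective. With
  \<open>surjects_onto_card\<close>, this is what makes the order antisymmetric.\<close>

lemma surjects_onto_isomorphic:
  assumes "is_multigraph H" "surjects_onto H G"
    and "card (verts H) = card (verts G)" "card (edges H) = card (edges G)"
  shows "isomorphic H G"
  using assms unfolding surjects_onto_def isomorphic_def is_multigraph_def bij_betw_def
  by (metis eq_card_imp_inj_on)

lemma remove_isolated_simps [simp]:
  "edges (remove_isolated G) = edges G" "ends (remove_isolated G) = ends G"
  by (simp_all add: remove_isolated_def)

lemma verts_remove_isolated:
  "is_multigraph G \<Longrightarrow> verts (remove_isolated G) = spanned_verts G"
  by (auto simp: remove_isolated_def spanned_verts_def is_multigraph_def)

lemma is_multigraph_remove_isolated: "is_multigraph G \<Longrightarrow> is_multigraph (remove_isolated G)"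
  by (auto simp: is_multigraph_def remove_isolated_def)

lemma no_isolated_remove_isolated: "no_isolated (remove_isolated G)"
  by (auto simp: no_isolated_def remove_isolated_def)

lemma remove_isolated_id: "no_isolated G \<Longrightarrow> remove_isolated G = G"
  unfolding no_isolated_def remove_isolated_def
  by (rule multigraph.equality) auto

lemma spanned_verts_subset: "is_multigraph G \<Longrightarrow> spanned_verts G \<subseteq> verts G"
  by (auto simp: is_multigraph_def spanned_verts_def)

text \<open>Each edge touches two vertices. This is where the bound 2n of the later statements comes
  from.\<close>

lemma card_spanned_verts_le:
  assumes "is_multigraph G"
  shows "card (spanned_verts G) \<le> 2 * card (edges G)"
proof -
  have "card (spanned_verts G) \<le> (\<Sum>e\<in>edges G. card (ends G e))"
    unfolding spanned_verts_def using assms by (intro card_UN_le) (auto simp: is_multigraph_def)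
  also have "\<dots> = 2 * card (edges G)" using assms by (simp add: is_multigraph_def)
  finally show ?thesis .
qed

text \<open>The image of \<open>\<phi>\<close> is forced to be the set of all touched vertices of
  \<open>G\<close>, because \<open>\<psi>\<close> hits every edge; so injectivity suffices. The
  values of \<open>\<phi>\<close> at isolated vertices are free, and the two graphs may differ in
  their numbers of vertices.\<close>

lemma isomorphic_remove_isolatedI:
  assumes G: "is_multigraph G" and H: "is_multigraph H"
    and \<phi>: "inj_on \<phi> (spanned_verts H)" and \<psi>: "bij_betw \<psi> (edges H) (edges G)"
    and e: "\<And>e. e \<in> edges H \<Longrightarrow> ends G (\<psi> e) = \<phi> ` ends H e"
  shows "isomorphic (remove_isolated H) (remove_isolated G)"
proof -
  have "\<phi> ` spanned_verts H = (\<Union>e\<in>edges H. ends G (\<psi> e))"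
    using e by (simp add: spanned_verts_def image_UN)
  also have "\<dots> = spanned_verts G"
    by (simp add: spanned_verts_def flip: bij_betw_imp_surj_on[OF \<psi>])
  finally have "\<phi> ` spanned_verts H = spanned_verts G" .
  then show ?thesis
    unfolding isomorphic_def multigraph_map_def
    using \<phi> \<psi> e by (intro exI[of _ \<phi>] exI[of _ \<psi>])
      (auto simp: verts_remove_isolated G H bij_betw_def)
qed

lemma isomorphic_remove_isolatedE:
  assumes G: "is_multigraph G" and H: "is_multigraph H"
    and "isomorphic (remove_isolated H) (remove_isolated G)"
  obtains \<phi> \<psi> where "bij_betw \<phi> (spanned_verts H) (spanned_verts G)"
    "bij_betw \<psi> (edges H) (edges G)" "\<And>e. e \<in> edges H \<Longrightarrow> ends G (\<psi> e) = \<phi> ` ends H e"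
  using assms unfolding isomorphic_def multigraph_map_def
  by (auto simp: verts_remove_isolated)

lemma isomorphic_remove_isolated:
  assumes G: "is_multigraph G" and H: "is_multigraph H" and "isomorphic H G"
  shows "isomorphic (remove_isolated H) (remove_isolated G)"
proof -
  obtain \<phi> \<psi> where "multigraph_map \<phi> \<psi> H G"
    "bij_betw \<phi> (verts H) (verts G)" "bij_betw \<psi> (edges H) (edges G)"
    using assms unfolding isomorphic_def by blast
  then show ?thesis
    using spanned_verts_subset[OF H]
    by (intro isomorphic_remove_isolatedI[OF G H, of \<phi> \<psi>])
      (auto simp: multigraph_map_def bij_betw_def dest: inj_on_subset)
qed

text \<open>Equal totals leave equally many isolated vertices on both sides. Any bijection
  \<open>\<zeta>\<close> between these can be glued to \<open>\<phi>\<close>, as no edge sees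
  it.\<close>

lemma isomorphic_of_remove_isolated:
  assumes G: "is_multigraph G" and H: "is_multigraph H"
    and iso: "isomorphic (remove_isolated H) (remove_isolated G)"
    and card: "card (verts H) = card (verts G)"
  shows "isomorphic H G"
proof -
  obtain \<phi> \<psi> where \<phi>: "bij_betw \<phi> (spanned_verts H) (spanned_verts G)"
    and \<psi>: "bij_betw \<psi> (edges H) (edges G)"
    and e: "\<And>e. e \<in> edges H \<Longrightarrow> ends G (\<psi> e) = \<phi> ` ends H e"
    using isomorphic_remove_isolatedE[OF G H iso] by blast
  have fin: "finite (verts H)" "finite (verts G)"
    using G H by (auto simp: is_multigraph_def)
  note sub = spanned_verts_subset[OF G] spanned_verts_subset[OF H]
  have "card (verts H - spanned_verts H) = card (verts G - spanned_verts G)"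
    using fin sub bij_betw_same_card[OF \<phi>] card by (simp add: card_Diff_subset finite_subset)
  then obtain \<zeta> where \<zeta>: "bij_betw \<zeta> (verts H - spanned_verts H) (verts G - spanned_verts G)"
    using fin by (meson finite_Diff finite_same_card_bij)
  define \<theta> where "\<theta> v = (if v \<in> spanned_verts H then \<phi> v else \<zeta> v)" for v
  have "bij_betw \<theta> (spanned_verts H) (spanned_verts G)"
    using \<phi> by (rule bij_betw_cong[THEN iffD1, rotated]) (simp add: \<theta>_def)
  moreover have "bij_betw \<theta> (verts H - spanned_verts H) (verts G - spanned_verts G)"
    using \<zeta> by (rule bij_betw_cong[THEN iffD1, rotated]) (simp add: \<theta>_def)
  ultimately have "bij_betw \<theta> (spanned_verts H \<union> (verts H - spanned_verts H))
      (spanned_verts G \<union> (verts G - spanned_verts G))"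
    by (rule bij_betw_combine) auto
  then have \<theta>: "bij_betw \<theta> (verts H) (verts G)"
    using sub by (simp add: Un_absorb1)
  have "ends G (\<psi> d) = \<theta> ` ends H d" if "d \<in> edges H" for d
  proof -
    have "\<theta> ` ends H d = \<phi> ` ends H d"
      using that by (intro image_cong) (auto simp: \<theta>_def spanned_verts_def)
    then show ?thesis using e that by simp
  qed
  then have "multigraph_map \<theta> \<psi> H G"
    using \<theta> \<psi> by (auto simp: multigraph_map_def bij_betw_def)
  with \<theta> \<psi> show ?thesis unfolding isomorphic_def by blast
qed

lemma add_isolated_verts:
  fixes G :: "(nat, 'e) multigraph"
  assumes "is_multigraph G" "card (verts G) \<le> q"
  obtains G' where "is_multigraph G'" "edges G' = edges G" "card (verts G') = q"
    "remove_isolated G' = remove_isolated G"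
proof -
  have "infinite (UNIV - verts G)" using assms by (simp add: is_multigraph_def Diff_infinite_finite)
  then obtain N where N: "finite N" "card N = q - card (verts G)" "N \<subseteq> UNIV - verts G"
    by (meson infinite_arbitrarily_large)
  let ?G = "G\<lparr>verts := verts G \<union> N\<rparr>"
  have "card (verts G \<union> N) = q"
    using N assms by (subst card_Un_disjoint) (auto simp: is_multigraph_def)
  moreover have "is_multigraph ?G" using assms N by (auto simp: is_multigraph_def)
  moreover have "remove_isolated ?G = remove_isolated G"
    using assms unfolding is_multigraph_def remove_isolated_def
    by (intro multigraph.equality) auto
  ultimately show ?thesis by (intro that[of ?G]) auto
qed

section \<open>Isomorphism classes and the removal of isolated vertices\<close>

lemma iso_class_self: "is_multigraph G \<Longrightarrow> G \<in> iso_class G"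
  by (simp add: iso_class_def isomorphic_refl)

lemma iso_class_eq_iff:
  assumes "is_multigraph G" "is_multigraph H"
  shows "iso_class G = iso_class H \<longleftrightarrow> isomorphic G H"
proof
  assume "iso_class G = iso_class H"
  then show "isomorphic G H" using iso_class_self[OF assms(2)] by (auto simp: iso_class_def)
next
  assume GH: "isomorphic G H"
  then have "isomorphic H G" using assms by (blast intro: isomorphic_sym)
  with GH show "iso_class G = iso_class H"
    unfolding iso_class_def by (blast intro: isomorphic_trans)
qed

lemma mem_iso_class_iff:
  assumes "is_multigraph G" "is_multigraph H"
  shows "H \<in> iso_class G \<longleftrightarrow> iso_class H = iso_class G"
  using assms isomorphic_sym by (simp add: iso_class_eq_iff) (auto simp: iso_class_def)

text \<open>Eliminates the arbitrary representative in \<open>tilde\<close>: removing isolated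
  vertices respects isomorphism, so any representative may be used.\<close>

lemma tilde_iso_class:
  assumes G: "is_multigraph G"
  shows "tilde (iso_class G) = iso_class (remove_isolated G)"
proof -
  define H where "H = (SOME H. H \<in> iso_class G)"
  have "H \<in> iso_class G" unfolding H_def using iso_class_self[OF G] by (rule someI)
  then have "is_multigraph H" "isomorphic G H" by (auto simp: iso_class_def)
  then have "iso_class (remove_isolated G) = iso_class (remove_isolated H)"
    using G by (simp add: iso_class_eq_iff is_multigraph_remove_isolated isomorphic_remove_isolated)
  then show ?thesis by (simp only: tilde_def H_def)
qed

text \<open>For fixed \<open>p\<close> the number of isolated vertices is determined by the rest of
  the graph, so removing them loses nothing.\<close>

lemma inj_on_tilde: "inj_on tilde (Hnp n p)"
proof (rule inj_onI)
  fix g h assume "g \<in> Hnp n p" "h \<in> Hnp n p" and eq: "tilde g = tilde h"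
  then obtain G H where G: "is_multigraph G" "g = iso_class G" "card (verts G) = p"
    and H: "is_multigraph H" "h = iso_class H" "card (verts H) = p"
    unfolding Hnp_def by blast
  then have "isomorphic (remove_isolated G) (remove_isolated H)"
    using eq by (simp add: tilde_iso_class iso_class_eq_iff is_multigraph_remove_isolated)
  then have "isomorphic G H"
    using isomorphic_of_remove_isolated[OF H(1) G(1)] G(3) H(3) by simp
  then show "g = h" using G H by (simp add: iso_class_eq_iff)
qed

lemma tilde_in_Hn:
  assumes "h \<in> Hnp n p" shows "tilde h \<in> Hn n"
proof -
  obtain G where "is_multigraph G" "card (edges G) = n" "h = iso_class G"
    using assms unfolding Hnp_def by blast
  then show ?thesis
    unfolding Hn_def
    by (auto simp: tilde_iso_class intro!: exI[of _ "remove_isolated G"]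
        is_multigraph_remove_isolated no_isolated_remove_isolated)
qed

lemma tilde_image_mono:
  assumes "p \<le> q" shows "tilde ` Hnp n p \<subseteq> tilde ` Hnp n q"
proof
  fix g assume "g \<in> tilde ` Hnp n p"
  then obtain G where G: "is_multigraph G" "card (edges G) = n" "card (verts G) = p"
    and g: "g = tilde (iso_class G)"
    unfolding Hnp_def by blast
  obtain G' where G': "is_multigraph G'" "edges G' = edges G" "card (verts G') = q"
    "remove_isolated G' = remove_isolated G"
    using add_isolated_verts[of G q] G assms by auto
  then have "g = tilde (iso_class G')" using g G by (simp add: tilde_iso_class)
  moreover have "iso_class G' \<in> Hnp n q" using G G' unfolding Hnp_def by auto
  ultimately show "g \<in> tilde ` Hnp n q" by blast
qed

text \<open>A class in \<open>Hn n\<close> has at most 2n vertices, so isolated ones can be added to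
  reach any p \<ge> 2n. With \<open>inj_on_tilde\<close>, \<open>Hnp n p\<close> is then a copy of
  \<open>Hn n\<close>.\<close>

lemma tilde_image_eq:
  assumes "2 * n \<le> p" shows "tilde ` Hnp n p = Hn n"
proof
  show "tilde ` Hnp n p \<subseteq> Hn n" using tilde_in_Hn by blast
  show "Hn n \<subseteq> tilde ` Hnp n p"
  proof
    fix g assume "g \<in> Hn n"
    then obtain G where G: "is_multigraph G" "card (edges G) = n" "no_isolated G"
      "g = iso_class G" unfolding Hn_def by blast
    have "card (verts G) \<le> 2 * n"
      using card_spanned_verts_le[OF G(1)] verts_remove_isolated[OF G(1)] G
      by (simp add: remove_isolated_id)
    moreover have "g = tilde (iso_class G)" using G by (simp add: tilde_iso_class remove_isolated_id)
    ultimately have "g \<in> tilde ` Hnp n (card (verts G))" "card (verts G) \<le> p"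
      using G assms unfolding Hnp_def by auto
    then show "g \<in> tilde ` Hnp n p" using tilde_image_mono by blast
  qed
qed

section \<open>Classes of index tuples\<close>

lemma isomorphic_edge_cong:
  assumes "verts G = verts H" "edges G = edges H" "\<And>e. e \<in> edges H \<Longrightarrow> ends G e = ends H e"
  shows "isomorphic G H"
  using assms unfolding isomorphic_def multigraph_map_def
  by (intro exI[of _ id]) auto

definition vertex_pairs :: "nat \<Rightarrow> (nat \<times> nat) set" where
  "vertex_pairs p = {(a, b). a \<in> {1..p} \<and> b \<in> {1..p} \<and> a \<noteq> b}"

definition shifts :: "nat \<Rightarrow> nat \<Rightarrow> (nat \<Rightarrow> nat \<times> nat) set" where
  "shifts n k = ({1..n} \<rightarrow>\<^sub>E {1..k} \<times> {1..k})"

definition \<Gamma>_class :: "nat \<Rightarrow> nat \<Rightarrow> (nat \<Rightarrow> nat \<times> nat) \<Rightarrow> graph_class" where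
  "\<Gamma>_class n p ab = iso_class (\<Gamma> n p ab)"

text \<open>Index, in the grid with \<open>k * p\<close> cells, of the \<open>i\<close>-th of the
  \<open>k\<close> parts of cell \<open>a\<close>. Numbering starts at 1, so \<open>a\<close> and
  \<open>i\<close> are recovered by dividing \<open>subcell k a i - 1\<close> by
  \<open>k\<close>.\<close>

definition subcell :: "nat \<Rightarrow> nat \<Rightarrow> nat \<Rightarrow> nat" where
  "subcell k a i = k * (a - 1) + i"

lemma index_tuples_alt: "index_tuples n p = ({1..n} \<rightarrow>\<^sub>E vertex_pairs p)"
  by (simp add: index_tuples_def vertex_pairs_def)

lemma finite_vertex_pairs: "finite (vertex_pairs p)"
  by (rule finite_subset[of _ "{1..p} \<times> {1..p}"]) (auto simp: vertex_pairs_def)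

lemma finite_index_tuples: "finite (index_tuples n p)"
  by (simp add: index_tuples_alt finite_PiE finite_vertex_pairs)

lemma finite_shifts: "finite (shifts n k)"
  by (simp add: shifts_def finite_PiE)

lemma \<Gamma>_simps [simp]:
  "verts (\<Gamma> n p ab) = {1..p}" "edges (\<Gamma> n p ab) = {1..n}"
  "ends (\<Gamma> n p ab) l = {fst (ab l), snd (ab l)}"
  by (simp_all add: \<Gamma>_def)

lemma is_multigraph_\<Gamma>:
  assumes "ab \<in> {1..n} \<rightarrow> vertex_pairs p"
  shows "is_multigraph (\<Gamma> n p ab)"
  using assms by (auto simp: is_multigraph_def vertex_pairs_def Pi_def card_insert_if)

lemma subcell_div_mod:
  assumes "i \<in> {1..k}"
  shows "(subcell k a i - 1) div k = a - 1" "(subcell k a i - 1) mod k = i - 1"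
proof -
  have "subcell k a i - 1 = (i - 1) + k * (a - 1)" "i - 1 < k"
    using assms by (auto simp: subcell_def)
  then show "(subcell k a i - 1) div k = a - 1" "(subcell k a i - 1) mod k = i - 1" by simp_all
qed

lemma subcell_eq_iff:
  assumes "1 \<le> a" "1 \<le> b" "i \<in> {1..k}" "j \<in> {1..k}"
  shows "subcell k a i = subcell k b j \<longleftrightarrow> a = b \<and> i = j"
proof
  assume "subcell k a i = subcell k b j"
  then have "a - 1 = b - 1" "i - 1 = j - 1"
    using subcell_div_mod assms(3,4) by metis+
  then show "a = b \<and> i = j" using assms by auto
qed simp

lemma subcell_mem:
  assumes "a \<in> {1..p}" "i \<in> {1..k}" shows "subcell k a i \<in> {1..k * p}"
proof -
  have "k * (a - 1) + k \<le> k * p"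
    using assms by (metis add.commute atLeastAtMost_iff le_add_diff_inverse2 mult_Suc_right mult_le_mono2 plus_1_eq_Suc)
  then show ?thesis using assms by (auto simp: subcell_def)
qed

lemma subcell_surj:
  assumes "v \<in> {1..k * p}"
  obtains a i where "a \<in> {1..p}" "i \<in> {1..k}" "v = subcell k a i"
proof
  have k: "k > 0" using assms by (cases k) auto
  have "v - 1 < p * k" using assms by (auto simp: mult.commute)
  then have "(v - 1) div k < p" using less_mult_imp_div_less by blast
  then show "(v - 1) div k + 1 \<in> {1..p}" by simp
  have "(v - 1) mod k < k" using k by simp
  then show "(v - 1) mod k + 1 \<in> {1..k}" by simp
  have "k * ((v - 1) div k) + (v - 1) mod k = v - 1" by simp
  then show "v = subcell k ((v - 1) div k + 1) ((v - 1) mod k + 1)"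
    using assms by (simp only: subcell_def) auto
qed

lemma subcell_subcell:
  assumes "i \<ge> 1"
  shows "subcell k1 (subcell k2 a i) j = subcell (k1 * k2) a (subcell k1 i j)"
proof -
  have "subcell k2 a i - 1 = k2 * (a - 1) + (i - 1)" using assms by (simp add: subcell_def)
  then show ?thesis by (simp add: subcell_def algebra_simps)
qed

lemma refine_alt:
  "refine k ab ij l = (subcell k (fst (ab l)) (fst (ij l)), subcell k (snd (ab l)) (snd (ij l)))"
  by (simp add: refine_def subcell_def)

lemma subcell_pair_mem:
  assumes "(a, b) \<in> vertex_pairs p" "i \<in> {1..k}" "j \<in> {1..k}"
  shows "(subcell k a i, subcell k b j) \<in> vertex_pairs (k * p)"
proof -
  have ab: "a \<in> {1..p}" "b \<in> {1..p}" "a \<noteq> b" using assms(1) by (simp_all add: vertex_pairs_def)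
  then have "subcell k a i \<noteq> subcell k b j" using assms(2,3) by (simp add: subcell_eq_iff)
  then show ?thesis
    using subcell_mem[OF ab(1) assms(2)] subcell_mem[OF ab(2) assms(3)] by (simp add: vertex_pairs_def)
qed

lemma refine_mem:
  assumes ab: "ab \<in> {1..n} \<rightarrow> vertex_pairs p" and ij: "ij \<in> shifts n k"
  shows "refine k ab ij \<in> {1..n} \<rightarrow> vertex_pairs (k * p)"
proof
  fix l assume l: "l \<in> {1..n}"
  have "(fst (ab l), snd (ab l)) \<in> vertex_pairs p" using ab l by auto
  moreover have "fst (ij l) \<in> {1..k}" "snd (ij l) \<in> {1..k}"
    using PiE_mem[OF ij[unfolded shifts_def] l] by (auto simp: mem_Times_iff)
  ultimately show "refine k ab ij l \<in> vertex_pairs (k * p)"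
    unfolding refine_alt by (rule subcell_pair_mem)
qed

text \<open>Many lemmas below assume only membership in
  \<open>{1..n} \<rightarrow> vertex_pairs p\<close>, since \<open>refine\<close> is not restricted
  to \<open>{1..n}\<close>. This lemma passes to the restricted tuple, which lies in
  \<open>index_tuples\<close>.\<close>

lemma \<Gamma>_class_cong:
  assumes "ab \<in> {1..n} \<rightarrow> vertex_pairs p" "\<And>l. l \<in> {1..n} \<Longrightarrow> ab' l = ab l"
  shows "\<Gamma>_class n p ab' = \<Gamma>_class n p ab"
proof -
  have "ab' \<in> {1..n} \<rightarrow> vertex_pairs p" using assms by auto
  moreover have "isomorphic (\<Gamma> n p ab') (\<Gamma> n p ab)"
    using assms(2) by (intro isomorphic_edge_cong) auto
  ultimately show ?thesis using assms(1)
    unfolding \<Gamma>_class_def by (simp add: iso_class_eq_iff is_multigraph_\<Gamma>)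
qed

text \<open>Vertices and edges are numbered arbitrarily, and the endpoints of each edge are put in
  one of the two orders.\<close>

lemma isomorphic_\<Gamma>:
  assumes G: "is_multigraph G" "card (edges G) = n" "card (verts G) = p"
  obtains ab where "ab \<in> index_tuples n p" "isomorphic G (\<Gamma> n p ab)"
proof -
  obtain \<phi> where \<phi>: "bij_betw \<phi> (verts G) {1..p}"
    using G finite_same_card_bij[of "verts G" "{1..p}"] by (auto simp: is_multigraph_def)
  obtain \<psi> where \<psi>: "bij_betw \<psi> (edges G) {1..n}"
    using G finite_same_card_bij[of "edges G" "{1..n}"] by (auto simp: is_multigraph_def)
  let ?\<theta> = "inv_into (edges G) \<psi>"
  have "\<exists>x\<in>vertex_pairs p. {fst x, snd x} = \<phi> ` ends G (?\<theta> l)" if "l \<in> {1..n}" for l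
  proof -
    have "?\<theta> l \<in> edges G" using \<psi> that by (metis bij_betw_imp_surj_on inv_into_into)
    then obtain u v where uv: "ends G (?\<theta> l) = {u, v}" "u \<noteq> v" "u \<in> verts G" "v \<in> verts G"
      using G(1) by (auto simp: is_multigraph_def card_2_iff)
    then have "(\<phi> u, \<phi> v) \<in> vertex_pairs p"
      using \<phi> by (auto simp: vertex_pairs_def bij_betw_def inj_on_eq_iff)
    with uv show ?thesis by (intro bexI[of _ "(\<phi> u, \<phi> v)"]) auto
  qed
  then obtain f where f: "\<And>l. l \<in> {1..n} \<Longrightarrow> f l \<in> vertex_pairs p \<and> {fst (f l), snd (f l)} = \<phi> ` ends G (?\<theta> l)"
    by metis
  show ?thesis
  proof
    show "restrict f {1..n} \<in> index_tuples n p" using f by (auto simp: index_tuples_alt)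
    have "multigraph_map \<phi> \<psi> G (\<Gamma> n p (restrict f {1..n}))"
      unfolding multigraph_map_def
    proof (intro conjI ballI)
      fix e assume e: "e \<in> edges G"
      then have "\<psi> e \<in> {1..n}" using \<psi> by (auto dest: bij_betwE)
      then show "ends (\<Gamma> n p (restrict f {1..n})) (\<psi> e) = \<phi> ` ends G e"
        using f[of "\<psi> e"] \<psi> e by (simp add: bij_betw_inv_into_left)
    qed (use \<phi> \<psi> in \<open>auto dest: bij_betwE\<close>)
    with \<phi> \<psi> show "isomorphic G (\<Gamma> n p (restrict f {1..n}))"
      unfolding isomorphic_def by auto
  qed
qed

lemma Hnp_alt: "Hnp n p = \<Gamma>_class n p ` index_tuples n p"
proof
  show "Hnp n p \<subseteq> \<Gamma>_class n p ` index_tuples n p"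
  proof
    fix h assume "h \<in> Hnp n p"
    then obtain G where G: "is_multigraph G" "card (edges G) = n" "card (verts G) = p" "h = iso_class G"
      unfolding Hnp_def by blast
    from isomorphic_\<Gamma>[OF G(1,2,3)] obtain ab where ab: "ab \<in> index_tuples n p" "isomorphic G (\<Gamma> n p ab)"
      by blast
    then have "is_multigraph (\<Gamma> n p ab)" by (auto simp: index_tuples_alt PiE_def is_multigraph_\<Gamma>)
    then have "h = \<Gamma>_class n p ab" using G ab by (simp add: \<Gamma>_class_def iso_class_eq_iff)
    with ab show "h \<in> \<Gamma>_class n p ` index_tuples n p" by blast
  qed
next
  show "\<Gamma>_class n p ` index_tuples n p \<subseteq> Hnp n p"
  proof
    fix h assume "h \<in> \<Gamma>_class n p ` index_tuples n p"
    then obtain ab where ab: "ab \<in> index_tuples n p" "h = iso_class (\<Gamma> n p ab)"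
      unfolding \<Gamma>_class_def by blast
    then have "is_multigraph (\<Gamma> n p ab)" by (auto simp: index_tuples_alt PiE_def is_multigraph_\<Gamma>)
    with ab show "h \<in> Hnp n p" unfolding Hnp_def by (auto intro!: exI[of _ "\<Gamma> n p ab"])
  qed
qed

lemma finite_Hnp: "finite (Hnp n p)"
  by (simp add: Hnp_alt finite_index_tuples)

lemma finite_Hn: "finite (Hn n)"
  using tilde_image_eq[of n "2 * n"] finite_Hnp by (metis finite_imageI order_refl)

lemma card_Hnp: "2 * n \<le> p \<Longrightarrow> card (Hnp n p) = card (Hn n)"
  using card_image[OF inj_on_tilde] tilde_image_eq by metis

lemma \<Gamma>_class_in_Hnp:
  assumes "ab \<in> {1..n} \<rightarrow> vertex_pairs p" shows "\<Gamma>_class n p ab \<in> Hnp n p"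
proof -
  have "\<Gamma>_class n p ab = \<Gamma>_class n p (restrict ab {1..n})"
    using assms by (intro \<Gamma>_class_cong) auto
  moreover have "restrict ab {1..n} \<in> index_tuples n p" using assms by (auto simp: index_tuples_alt)
  ultimately show ?thesis by (simp add: Hnp_alt)
qed

text \<open>An isomorphism moves a choice of parts along the edges: edge \<open>l\<close> becomes
  \<open>\<psi> l\<close> and takes its pair with it. The refined graphs then match, because a
  vertex of a refinement is an old vertex together with a position in it. Isolated vertices are
  removed on both sides, so \<open>p\<close> and \<open>p'\<close> may differ.\<close>

lemma refine_transport:
  assumes ab: "ab \<in> {1..n} \<rightarrow> vertex_pairs p" and ab': "ab' \<in> {1..n} \<rightarrow> vertex_pairs p'"
    and iso: "isomorphic (remove_isolated (\<Gamma> n p ab)) (remove_isolated (\<Gamma> n p' ab'))"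
  obtains T where "bij_betw T (shifts n k) (shifts n k)"
    "\<And>ij. ij \<in> shifts n k \<Longrightarrow> isomorphic (remove_isolated (\<Gamma> n (k * p) (refine k ab ij)))
       (remove_isolated (\<Gamma> n (k * p') (refine k ab' (T ij))))"
proof -
  obtain \<phi> \<psi> where \<phi>: "bij_betw \<phi> (spanned_verts (\<Gamma> n p ab)) (spanned_verts (\<Gamma> n p' ab'))"
    and \<psi>: "bij_betw \<psi> {1..n} {1..n}"
    and e: "\<And>l. l \<in> {1..n} \<Longrightarrow> {fst (ab' (\<psi> l)), snd (ab' (\<psi> l))} = {\<phi> (fst (ab l)), \<phi> (snd (ab l))}"
    using isomorphic_remove_isolatedE[OF is_multigraph_\<Gamma>[OF ab'] is_multigraph_\<Gamma>[OF ab] iso] by auto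
  define \<theta> where "\<theta> = inv_into {1..n} \<psi>"
  have \<theta>: "\<And>l. l \<in> {1..n} \<Longrightarrow> \<theta> l \<in> {1..n}" "\<And>l. l \<in> {1..n} \<Longrightarrow> \<psi> (\<theta> l) = l"
    "\<And>l. l \<in> {1..n} \<Longrightarrow> \<theta> (\<psi> l) = l" "\<And>l. l \<in> {1..n} \<Longrightarrow> \<psi> l \<in> {1..n}"
    unfolding \<theta>_def using \<psi>
    by (metis bij_betw_imp_surj_on inv_into_into, simp add: bij_betw_inv_into_right,
        simp add: bij_betw_inv_into_left, auto dest: bij_betwE)
  \<comment> \<open>\<open>ab\<close> and \<open>ab'\<close> may list the endpoints of corresponding
    edges in opposite orders; the pair of positions is swapped exactly there. Each
    \<open>orient l\<close> is an involution, so it also serves in the inverse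
    \<open>T'\<close>.\<close>
  define orient where "orient l x = (if fst (ab' (\<psi> l)) = \<phi> (fst (ab l)) then x else prod.swap x)"
    for l and x :: "nat \<times> nat"
  have orient2: "orient l (orient l x) = x" for l x by (simp add: orient_def)
  have orient_mem: "orient l x \<in> {1..k} \<times> {1..k} \<longleftrightarrow> x \<in> {1..k} \<times> {1..k}" for l x
    by (cases x) (auto simp: orient_def)
  define T where "T ij = (\<lambda>m\<in>{1..n}. orient (\<theta> m) (ij (\<theta> m)))" for ij
  define T' where "T' ij = (\<lambda>l\<in>{1..n}. orient l (ij (\<psi> l)))" for ij
  have "bij_betw T (shifts n k) (shifts n k)"
  proof (rule bij_betw_byWitness[where f' = T'])
    show "\<forall>ij\<in>shifts n k. T' (T ij) = ij"
    proof
      fix ij assume "ij \<in> shifts n k"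
      then have "ij \<in> extensional {1..n}" by (simp add: shifts_def PiE_def)
      then show "T' (T ij) = ij"
        by (intro extensionalityI[of _ "{1..n}"])
          (simp_all add: T_def T'_def \<theta> orient2 del: atLeastAtMost_iff One_nat_def)
    qed
    show "\<forall>ij\<in>shifts n k. T (T' ij) = ij"
    proof
      fix ij assume "ij \<in> shifts n k"
      then have "ij \<in> extensional {1..n}" by (simp add: shifts_def PiE_def)
      then show "T (T' ij) = ij"
        by (intro extensionalityI[of _ "{1..n}"])
          (simp_all add: T_def T'_def \<theta> orient2 del: atLeastAtMost_iff One_nat_def)
    qed
    have mem: "ij l \<in> {1..k} \<times> {1..k}" if "ij \<in> shifts n k" "l \<in> {1..n}" for ij l
      using that unfolding shifts_def by (rule PiE_mem)
    show "T ` shifts n k \<subseteq> shifts n k"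
    proof (rule image_subsetI)
      fix ij assume "ij \<in> shifts n k"
      then show "T ij \<in> shifts n k"
        unfolding T_def shifts_def[of n k] using mem \<theta>(1) orient_mem by (simp only: restrict_PiE_iff) blast
    qed
    show "T' ` shifts n k \<subseteq> shifts n k"
    proof (rule image_subsetI)
      fix ij assume "ij \<in> shifts n k"
      then show "T' ij \<in> shifts n k"
        unfolding T'_def shifts_def[of n k] using mem \<theta>(4) orient_mem by (simp only: restrict_PiE_iff) blast
    qed
  qed
  moreover
  have "isomorphic (remove_isolated (\<Gamma> n (k * p) (refine k ab ij)))
       (remove_isolated (\<Gamma> n (k * p') (refine k ab' (T ij))))" if ij: "ij \<in> shifts n k" for ij
  proof -
    have T: "T ij \<in> shifts n k" using ij calculation by (auto dest: bij_betwE)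
    \<comment> \<open>\<open>\<Phi>\<close> applies \<open>\<phi>\<close> to the old cell and keeps
      the position inside it.\<close>
    define \<Phi> where "\<Phi> v = subcell k (\<phi> ((v - 1) div k + 1)) ((v - 1) mod k + 1)" for v
    have \<Phi>: "\<Phi> (subcell k a i) = subcell k (\<phi> a) i" if "a \<ge> 1" "i \<in> {1..k}" for a i
      unfolding \<Phi>_def subcell_div_mod[OF that(2)] using that by simp
    let ?V = "spanned_verts (\<Gamma> n p ab)"
    have V: "?V \<subseteq> {1..p}" "spanned_verts (\<Gamma> n p' ab') \<subseteq> {1..p'}"
      using spanned_verts_subset[OF is_multigraph_\<Gamma>[OF ab]]
        spanned_verts_subset[OF is_multigraph_\<Gamma>[OF ab']] by auto
    have abV: "fst (ab l) \<in> ?V" "snd (ab l) \<in> ?V" if "l \<in> {1..n}" for l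
      using that by (auto simp: spanned_verts_def)
    have ijk: "fst (ij l) \<in> {1..k}" "snd (ij l) \<in> {1..k}" if "l \<in> {1..n}" for l
      using PiE_mem[OF ij[unfolded shifts_def] that] by (auto simp: mem_Times_iff)
    show ?thesis
    proof (rule isomorphic_remove_isolatedI[where \<phi> = \<Phi> and \<psi> = \<psi>])
      \<comment> \<open>\<open>\<phi>\<close> is controlled only on touched vertices, so injectivity
        of \<open>\<Phi>\<close> is shown on all parts of those, a set that contains every vertex
        touched in the refinement.\<close>
      have sub: "spanned_verts (\<Gamma> n (k * p) (refine k ab ij)) \<subseteq> (\<lambda>(a, i). subcell k a i) ` (?V \<times> {1..k})"
      proof
        fix v assume "v \<in> spanned_verts (\<Gamma> n (k * p) (refine k ab ij))"
        then obtain l where l: "l \<in> {1..n}"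
          "v = subcell k (fst (ab l)) (fst (ij l)) \<or> v = subcell k (snd (ab l)) (snd (ij l))"
          by (auto simp: spanned_verts_def refine_alt)
        then show "v \<in> (\<lambda>(a, i). subcell k a i) ` (?V \<times> {1..k})"
          using abV[OF l(1)] ijk[OF l(1)] by blast
      qed
      have "inj_on \<Phi> ((\<lambda>(a, i). subcell k a i) ` (?V \<times> {1..k}))"
      proof (rule inj_onI, clarsimp)
        fix a i b j assume *: "a \<in> ?V" "b \<in> ?V" "Suc 0 \<le> i" "i \<le> k" "Suc 0 \<le> j" "j \<le> k"
          and eq: "\<Phi> (subcell k a i) = \<Phi> (subcell k b j)"
        have "a \<ge> 1" "b \<ge> 1" using * V by auto
        moreover have "\<phi> a \<ge> 1" "\<phi> b \<ge> 1" using * V \<phi> by (auto dest!: bij_betwE)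
        ultimately have "\<phi> a = \<phi> b" "i = j" using eq * by (auto simp: \<Phi> subcell_eq_iff)
        then show "subcell k a i = subcell k b j"
          using * \<phi> by (auto simp: bij_betw_def inj_on_eq_iff)
      qed
      then show "inj_on \<Phi> (spanned_verts (\<Gamma> n (k * p) (refine k ab ij)))"
        using sub by (rule inj_on_subset)
      show "bij_betw \<psi> (edges (\<Gamma> n (k * p) (refine k ab ij))) (edges (\<Gamma> n (k * p') (refine k ab' (T ij))))"
        using \<psi> by simp
      fix l assume "l \<in> edges (\<Gamma> n (k * p) (refine k ab ij))"
      then have l: "l \<in> {1..n}" by simp
      have "T ij (\<psi> l) = orient l (ij l)" using l \<theta> by (simp add: T_def)
      moreover have "fst (ab l) \<ge> 1" "snd (ab l) \<ge> 1" using abV[OF l] V by auto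
      moreover have "(fst (ab' (\<psi> l)) = \<phi> (fst (ab l)) \<and> snd (ab' (\<psi> l)) = \<phi> (snd (ab l))) \<or>
        (fst (ab' (\<psi> l)) \<noteq> \<phi> (fst (ab l)) \<and> fst (ab' (\<psi> l)) = \<phi> (snd (ab l)) \<and> snd (ab' (\<psi> l)) = \<phi> (fst (ab l)))"
        using e[OF l] by (auto simp: doubleton_eq_iff)
      ultimately show "ends (\<Gamma> n (k * p') (refine k ab' (T ij))) (\<psi> l) =
          \<Phi> ` ends (\<Gamma> n (k * p) (refine k ab ij)) l"
        using ijk[OF l] by (auto simp: refine_alt \<Phi> orient_def insert_commute)
    qed (use is_multigraph_\<Gamma> refine_mem ab ab' ij T in blast)+
  qed
  ultimately show ?thesis by (rule that)
qed

text \<open>Evaluates the definite description in \<open>\<pi>\<close>. Existence is constancy of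
  the count, from \<open>refine_transport\<close>; uniqueness holds because \<open>ab\<close> itself
  is an admissible choice. A row of the matrix can thus be computed from any convenient
  tuple.\<close>

lemma \<pi>_eq:
  assumes p: "p \<ge> 2" and ab: "ab \<in> index_tuples n p" and h: "h \<in> Hn n"
  shows "\<pi> n k (tilde (\<Gamma>_class n p ab)) h =
    card {ij \<in> shifts n k. tilde (\<Gamma>_class n (k * p) (refine k ab ij)) = h}"
proof -
  obtain H where H: "is_multigraph H" "h = iso_class H" using h unfolding Hn_def by blast
  \<comment> \<open>Membership in a class becomes equality of classes, a condition that the
    bijection \<open>T\<close> below visibly preserves.\<close>
  have mem: "remove_isolated (\<Gamma> n q cd) \<in> g \<longleftrightarrow> tilde (\<Gamma>_class n q cd) = g"
    if "cd \<in> {1..n} \<rightarrow> vertex_pairs q" "is_multigraph G" "g = iso_class G" for q cd g G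
    using that is_multigraph_\<Gamma>[OF that(1)]
    by (simp add: mem_iso_class_iff is_multigraph_remove_isolated \<Gamma>_class_def tilde_iso_class)
  define N where "N q cd = card {ij \<in> shifts n k. remove_isolated (\<Gamma> n (k * q) (refine k cd ij)) \<in> h}" for q cd
  have N: "N q cd = card {ij \<in> shifts n k. tilde (\<Gamma>_class n (k * q) (refine k cd ij)) = h}"
    if "cd \<in> {1..n} \<rightarrow> vertex_pairs q" for q cd
    unfolding N_def by (rule arg_cong[where f = card], rule Collect_cong, rule conj_cong[OF refl])
      (rule mem[OF refine_mem[OF that] H])
  have abPi: "ab \<in> {1..n} \<rightarrow> vertex_pairs p" using ab by (simp add: index_tuples_alt PiE_def)
  have const: "N q cd = N p ab" if cd: "cd \<in> index_tuples n q"
    and g: "remove_isolated (\<Gamma> n q cd) \<in> tilde (\<Gamma>_class n p ab)" for q cd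
  proof -
    have cdPi: "cd \<in> {1..n} \<rightarrow> vertex_pairs q" using cd by (simp add: index_tuples_alt PiE_def)
    have "tilde (\<Gamma>_class n p ab) = iso_class (remove_isolated (\<Gamma> n p ab))"
      using is_multigraph_\<Gamma>[OF abPi] by (simp add: \<Gamma>_class_def tilde_iso_class)
    then have "isomorphic (remove_isolated (\<Gamma> n p ab)) (remove_isolated (\<Gamma> n q cd))"
      using g by (simp add: iso_class_def)
    from refine_transport[OF abPi cdPi this]
    obtain T where T: "bij_betw T (shifts n k) (shifts n k)" and iso:
      "\<And>ij. ij \<in> shifts n k \<Longrightarrow> isomorphic (remove_isolated (\<Gamma> n (k * p) (refine k ab ij)))
       (remove_isolated (\<Gamma> n (k * q) (refine k cd (T ij))))" by blast
    have eq: "tilde (\<Gamma>_class n (k * p) (refine k ab ij)) = tilde (\<Gamma>_class n (k * q) (refine k cd (T ij)))"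
      if ij: "ij \<in> shifts n k" for ij
    proof -
      have "T ij \<in> shifts n k" using T ij by (auto dest: bij_betwE)
      then show ?thesis
        using iso[OF ij] is_multigraph_\<Gamma>[OF refine_mem[OF abPi ij]] is_multigraph_\<Gamma>[OF refine_mem[OF cdPi]]
        by (simp add: \<Gamma>_class_def tilde_iso_class iso_class_eq_iff is_multigraph_remove_isolated)
    qed
    have "bij_betw T {ij \<in> shifts n k. tilde (\<Gamma>_class n (k * p) (refine k ab ij)) = h}
        {ij \<in> shifts n k. tilde (\<Gamma>_class n (k * q) (refine k cd ij)) = h}"
    proof (rule bij_betw_imageI)
      show "inj_on T {ij \<in> shifts n k. tilde (\<Gamma>_class n (k * p) (refine k ab ij)) = h}"
        by (rule inj_on_subset[OF bij_betw_imp_inj_on[OF T]]) auto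
      show "T ` {ij \<in> shifts n k. tilde (\<Gamma>_class n (k * p) (refine k ab ij)) = h} =
        {ij \<in> shifts n k. tilde (\<Gamma>_class n (k * q) (refine k cd ij)) = h}" (is "T ` ?X = ?Y")
      proof
        show "T ` ?X \<subseteq> ?Y" using eq bij_betwE[OF T] by auto
        show "?Y \<subseteq> T ` ?X"
        proof
          fix y assume y: "y \<in> ?Y"
          then obtain x where "x \<in> shifts n k" "y = T x" using T by (auto simp: bij_betw_def)
          then show "y \<in> T ` ?X" using y eq by auto
        qed
      qed
    qed
    from bij_betw_same_card[OF this] show ?thesis by (simp only: N[OF abPi] N[OF cdPi])
  qed
  have self: "remove_isolated (\<Gamma> n p ab) \<in> tilde (\<Gamma>_class n p ab)"
    using is_multigraph_\<Gamma>[OF abPi]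
    by (simp add: \<Gamma>_class_def tilde_iso_class iso_class_self is_multigraph_remove_isolated)
  have "\<pi> n k (tilde (\<Gamma>_class n p ab)) h = N p ab"
    unfolding \<pi>_def N_def[symmetric, unfolded shifts_def]
  proof (rule the_equality)
    show "\<forall>q\<ge>2. \<forall>cd\<in>index_tuples n q. remove_isolated (\<Gamma> n q cd) \<in> tilde (\<Gamma>_class n p ab) \<longrightarrow> N p ab = N q cd"
      using const by metis
    show "m = N p ab" if "\<forall>q\<ge>2. \<forall>cd\<in>index_tuples n q. remove_isolated (\<Gamma> n q cd) \<in> tilde (\<Gamma>_class n p ab) \<longrightarrow> m = N q cd" for m
      using that p ab self by blast
  qed
  then show ?thesis using N[OF abPi] by simp
qed

section \<open>The consistency maps\<close>

text \<open>An entry of \<open>\<pi>\<close> counts the splittings that give a prescribed class, so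
  the weighted sum over classes is a sum over splittings grouped by class. Injectivity of
  \<open>tilde\<close> on \<open>Hnp n (k * p)\<close> turns equality after removal of isolated
  vertices into equality of classes.\<close>

lemma consistency_\<Gamma>_class:
  assumes p: "p \<ge> 2" and ab: "ab \<in> {1..n} \<rightarrow> vertex_pairs p"
  shows "consistency n k p A (\<Gamma>_class n p ab) =
    (\<Sum>ij\<in>shifts n k. A (\<Gamma>_class n (k * p) (refine k ab ij)))"
proof -
  let ?cl = "\<lambda>ij. \<Gamma>_class n (k * p) (refine k ab ij)"
  let ?ab = "restrict ab {1..n}"
  have ab': "?ab \<in> index_tuples n p" using ab by (auto simp: index_tuples_alt)
  have cl_ab: "\<Gamma>_class n p ab = \<Gamma>_class n p ?ab"
    using ab by (intro \<Gamma>_class_cong) auto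
  have cl: "\<Gamma>_class n (k * p) (refine k ?ab ij) = ?cl ij" if "ij \<in> shifts n k" for ij
    using refine_mem[OF ab that] by (intro \<Gamma>_class_cong) (auto simp: refine_alt)
  have cl_mem: "?cl ij \<in> Hnp n (k * p)" if "ij \<in> shifts n k" for ij
    using refine_mem[OF ab that] by (rule \<Gamma>_class_in_Hnp)
  have "consistency n k p A (\<Gamma>_class n p ab) =
    (\<Sum>h\<in>Hnp n (k * p). real (\<pi> n k (tilde (\<Gamma>_class n p ab)) (tilde h)) * A h)"
    using \<Gamma>_class_in_Hnp[OF ab] by (simp add: consistency_def)
  also have "\<dots> = (\<Sum>h\<in>Hnp n (k * p). \<Sum>ij\<in>{ij \<in> shifts n k. ?cl ij = h}. A (?cl ij))"
  proof (rule sum.cong[OF refl])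
    fix h assume h: "h \<in> Hnp n (k * p)"
    have "{ij \<in> shifts n k. tilde (\<Gamma>_class n (k * p) (refine k ?ab ij)) = tilde h} =
        {ij \<in> shifts n k. ?cl ij = h}"
      using cl cl_mem h inj_on_eq_iff[OF inj_on_tilde] by (intro Collect_cong) (metis (no_types, lifting))
    then show "real (\<pi> n k (tilde (\<Gamma>_class n p ab)) (tilde h)) * A h =
        (\<Sum>ij\<in>{ij \<in> shifts n k. ?cl ij = h}. A (?cl ij))"
      using \<pi>_eq[OF p ab' tilde_in_Hn[OF h], of k] by (simp add: cl_ab)
  qed
  also have "\<dots> = (\<Sum>ij\<in>shifts n k. A (?cl ij))"
    using cl_mem by (intro sum.group) (auto simp: finite_Hnp finite_shifts)
  finally show ?thesis .
qed

lemma consistency_in_Xnp: "consistency n k p A \<in> Xnp n p"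
  by (simp add: consistency_def Xnp_def)

lemma consistency_add: "consistency n k p (A + B) = consistency n k p A + consistency n k p B"
  by (auto simp: consistency_def fun_eq_iff algebra_simps sum.distrib)

lemma consistency_scaleR: "consistency n k p (c *\<^sub>R A) = c *\<^sub>R consistency n k p A"
  by (auto simp: consistency_def fun_eq_iff scaleR_fun_def sum_distrib_left algebra_simps)

lemma subspace_Xnp: "subspace (Xnp n p)"
  by (auto simp: subspace_def Xnp_def scaleR_fun_def)

text \<open>Choosing one of \<open>k2\<close> parts and then one of its \<open>k1\<close> parts is
  choosing one of \<open>k1 * k2\<close> parts, independently at each edge and endpoint. The
  combined choice is restricted to \<open>{1..n}\<close> because elements of \<open>shifts\<close>
  are \<open>undefined\<close> elsewhere.\<close>

lemma sum_shifts_mult: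
  "(\<Sum>ij2\<in>shifts n k2. \<Sum>ij1\<in>shifts n k1. f (\<lambda>l\<in>{1..n}.
      (subcell k1 (fst (ij2 l)) (fst (ij1 l)), subcell k1 (snd (ij2 l)) (snd (ij1 l))))) =
    (\<Sum>ij\<in>shifts n (k1 * k2). f ij)"
proof -
  let ?c = "\<lambda>x y. (subcell k1 (fst x) (fst y), subcell k1 (snd x) (snd y))"
  let ?C = "\<lambda>(ij2, ij1). \<lambda>l\<in>{1..n}. ?c (ij2 l) (ij1 l)"
  have c_mem: "?c x y \<in> {1..k1 * k2} \<times> {1..k1 * k2}"
    if "x \<in> {1..k2} \<times> {1..k2}" "y \<in> {1..k1} \<times> {1..k1}" for x y
    using that by (simp only: mem_Times_iff fst_conv snd_conv subcell_mem)
  have c_inj: "x = x' \<and> y = y'"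
    if "x \<in> {1..k2} \<times> {1..k2}" "y \<in> {1..k1} \<times> {1..k1}"
      "x' \<in> {1..k2} \<times> {1..k2}" "y' \<in> {1..k1} \<times> {1..k1}" "?c x y = ?c x' y'" for x y x' y'
    using that by (auto simp: subcell_eq_iff)
  have c_surj: "\<exists>x\<in>{1..k2} \<times> {1..k2}. \<exists>y\<in>{1..k1} \<times> {1..k1}. z = ?c x y"
    if "z \<in> {1..k1 * k2} \<times> {1..k1 * k2}" for z
  proof -
    obtain u v where z: "z = (u, v)" "u \<in> {1..k1 * k2}" "v \<in> {1..k1 * k2}"
      using \<open>z \<in> _\<close> by (rule SigmaE)
    obtain a i where "a \<in> {1..k2}" "i \<in> {1..k1}" "u = subcell k1 a i"
      using z(2) by (rule subcell_surj)
    moreover obtain b j where "b \<in> {1..k2}" "j \<in> {1..k1}" "v = subcell k1 b j"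
      using z(3) by (rule subcell_surj)
    ultimately show ?thesis
      using z(1) by (intro bexI[of _ "(a, b)"] bexI[of _ "(i, j)"]) auto
  qed
  have mem: "ij l \<in> {1..k} \<times> {1..k}" if "ij \<in> shifts n k" "l \<in> {1..n}" for ij k l
    using that unfolding shifts_def by (rule PiE_mem)
  have "bij_betw ?C (shifts n k2 \<times> shifts n k1) (shifts n (k1 * k2))"
  proof (rule bij_betw_imageI)
    show "inj_on ?C (shifts n k2 \<times> shifts n k1)"
    proof (rule inj_onI, clarify)
      fix x y x' y' assume x: "x \<in> shifts n k2" "x' \<in> shifts n k2" and y: "y \<in> shifts n k1" "y' \<in> shifts n k1"
        and eq: "(\<lambda>l\<in>{1..n}. ?c (x l) (y l)) = (\<lambda>l\<in>{1..n}. ?c (x' l) (y' l))"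
      have "x l = x' l \<and> y l = y' l" if "l \<in> {1..n}" for l
        using fun_cong[OF eq, of l] that by (intro c_inj mem[OF _ that] x y) simp
      then show "x = x' \<and> y = y'"
        using x y unfolding shifts_def by (meson PiE_ext)
    qed
    show "?C ` (shifts n k2 \<times> shifts n k1) = shifts n (k1 * k2)"
    proof
      show "?C ` (shifts n k2 \<times> shifts n k1) \<subseteq> shifts n (k1 * k2)"
      proof (rule image_subsetI, clarify)
        fix x y assume "x \<in> shifts n k2" "y \<in> shifts n k1"
        then show "(\<lambda>l\<in>{1..n}. ?c (x l) (y l)) \<in> shifts n (k1 * k2)"
          unfolding shifts_def[of n "k1 * k2"] restrict_PiE_iff by (intro ballI c_mem mem)
      qed
      show "shifts n (k1 * k2) \<subseteq> ?C ` (shifts n k2 \<times> shifts n k1)"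
      proof
        fix z assume z: "z \<in> shifts n (k1 * k2)"
        have "\<forall>l\<in>{1..n}. \<exists>x. \<exists>y. x \<in> {1..k2} \<times> {1..k2} \<and> y \<in> {1..k1} \<times> {1..k1} \<and> z l = ?c x y"
          using c_surj[OF mem[OF z]] by blast
        then obtain x y where xy: "\<forall>l\<in>{1..n}. x l \<in> {1..k2} \<times> {1..k2} \<and> y l \<in> {1..k1} \<times> {1..k1} \<and> z l = ?c (x l) (y l)"
          unfolding bchoice_iff by blast
        have "z = ?C (restrict x {1..n}, restrict y {1..n})"
        proof
          fix l show "z l = ?C (restrict x {1..n}, restrict y {1..n}) l"
          proof (cases "l \<in> {1..n}")
            case True
            with xy have "z l = ?c (x l) (y l)" by blast
            with True show ?thesis by simp
          next
            case False
            with z have "z l = undefined" unfolding shifts_def by (intro PiE_arb)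
            then show ?thesis unfolding split_def restrict_def if_not_P[OF False] .
          qed
        qed
        moreover have "restrict x {1..n} \<in> shifts n k2" "restrict y {1..n} \<in> shifts n k1"
          unfolding shifts_def restrict_PiE_iff using xy by blast+
        then have "(restrict x {1..n}, restrict y {1..n}) \<in> shifts n k2 \<times> shifts n k1"
          by (rule SigmaI)
        ultimately show "z \<in> ?C ` (shifts n k2 \<times> shifts n k1)" by (rule image_eqI)
      qed
    qed
  qed
  from sum.reindex_bij_betw[OF this, of f] show ?thesis
    by (simp add: sum.cartesian_product split_def)
qed

lemma consistency_comp:
  assumes p: "p \<ge> 2" and k2: "k2 \<ge> 1"
  shows "consistency n (k1 * k2) p A = consistency n k2 p (consistency n k1 (k2 * p) A)"
proof
  fix g
  show "consistency n (k1 * k2) p A g = consistency n k2 p (consistency n k1 (k2 * p) A) g"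
  proof (cases "g \<in> Hnp n p")
    case False
    then show ?thesis by (simp add: consistency_def)
  next
    case True
    then obtain ab where "ab \<in> index_tuples n p" and g: "g = \<Gamma>_class n p ab"
      unfolding Hnp_alt by blast
    then have ab: "ab \<in> {1..n} \<rightarrow> vertex_pairs p" by (simp add: index_tuples_alt PiE_def)
    have p2: "k2 * p \<ge> 2" using p k2 by (metis mult.left_neutral mult_le_mono)
    have "consistency n k2 p (consistency n k1 (k2 * p) A) g =
      (\<Sum>ij2\<in>shifts n k2. \<Sum>ij1\<in>shifts n k1.
        A (\<Gamma>_class n (k1 * (k2 * p)) (refine k1 (refine k2 ab ij2) ij1)))"
      using consistency_\<Gamma>_class[OF p ab] consistency_\<Gamma>_class[OF p2 refine_mem[OF ab]]
      by (simp add: g)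
    also have "\<dots> = (\<Sum>ij2\<in>shifts n k2. \<Sum>ij1\<in>shifts n k1.
        A (\<Gamma>_class n (k1 * k2 * p) (refine (k1 * k2) ab (\<lambda>l\<in>{1..n}.
      (subcell k1 (fst (ij2 l)) (fst (ij1 l)), subcell k1 (snd (ij2 l)) (snd (ij1 l)))))))"
    proof (intro sum.cong refl arg_cong[where f = A])
      fix ij2 ij1 assume ij: "ij2 \<in> shifts n k2" "ij1 \<in> shifts n k1"
      have "fst (ij2 l) \<ge> 1 \<and> snd (ij2 l) \<ge> 1" if "l \<in> {1..n}" for l
        using PiE_mem[OF ij(1)[unfolded shifts_def] that] by (auto simp: mem_Times_iff)
      \<comment> \<open>The two index tuples are compared only on \<open>{1..n}\<close>, which is
        enough for \<open>\<Gamma>_class_cong\<close>.\<close>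
      then have "refine (k1 * k2) ab (\<lambda>l\<in>{1..n}.
          (subcell k1 (fst (ij2 l)) (fst (ij1 l)), subcell k1 (snd (ij2 l)) (snd (ij1 l)))) l =
          refine k1 (refine k2 ab ij2) ij1 l" if "l \<in> {1..n}" for l
        using that by (simp add: refine_alt subcell_subcell)
      then show "\<Gamma>_class n (k1 * (k2 * p)) (refine k1 (refine k2 ab ij2) ij1) =
        \<Gamma>_class n (k1 * k2 * p) (refine (k1 * k2) ab (\<lambda>l\<in>{1..n}.
          (subcell k1 (fst (ij2 l)) (fst (ij1 l)), subcell k1 (snd (ij2 l)) (snd (ij1 l)))))"
        using refine_mem[OF refine_mem[OF ab ij(1)] ij(2)]
        by (subst mult.assoc, intro \<Gamma>_class_cong[symmetric]) (auto simp: mult.assoc)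
    qed
    also have "\<dots> = (\<Sum>ij\<in>shifts n (k1 * k2). A (\<Gamma>_class n (k1 * k2 * p) (refine (k1 * k2) ab ij)))"
      by (rule sum_shifts_mult)
    also have "\<dots> = consistency n (k1 * k2) p A g"
      using consistency_\<Gamma>_class[OF p ab] by (simp add: g)
    finally show ?thesis by simp
  qed
qed

section \<open>Triangularity of the matrix and the partial order\<close>

lemma Hn_representative:
  assumes g: "g \<in> Hn n"
  obtains ab where "ab \<in> index_tuples n (2 * n)" "g = tilde (\<Gamma>_class n (2 * n) ab)"
  using g tilde_image_eq[of n "2 * n"] unfolding Hnp_alt by auto

text \<open>The quotient map \<open>\<phi>\<close> forgets the position inside the old cell; on
  edges the map is the identity. Touched vertices go onto touched vertices because edge
  \<open>l\<close> of the refinement lies over edge \<open>l\<close>.\<close>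

lemma surjects_onto_remove_isolated_refine:
  assumes ab: "ab \<in> {1..n} \<rightarrow> vertex_pairs p" and ij: "ij \<in> shifts n k"
  shows "surjects_onto (remove_isolated (\<Gamma> n (k * p) (refine k ab ij))) (remove_isolated (\<Gamma> n p ab))"
proof -
  define \<phi> where "\<phi> v = (v - 1) div k + 1" for v
  have \<phi>: "\<phi> (subcell k a i) = a" if "a \<ge> 1" "i \<in> {1..k}" for a i
    unfolding \<phi>_def subcell_div_mod[OF that(2)] using that by simp
  have ends: "{fst (ab l), snd (ab l)} = \<phi> ` {fst (refine k ab ij l), snd (refine k ab ij l)}"
    if l: "l \<in> {1..n}" for l
  proof -
    have "fst (ij l) \<in> {1..k}" "snd (ij l) \<in> {1..k}"
      using PiE_mem[OF ij[unfolded shifts_def] l] by (auto simp: mem_Times_iff)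
    moreover have "fst (ab l) \<ge> 1" "snd (ab l) \<ge> 1"
      using ab l by (auto simp: vertex_pairs_def Pi_def split_def)
    ultimately show ?thesis by (simp add: refine_alt \<phi>)
  qed
  then have "\<phi> ` spanned_verts (\<Gamma> n (k * p) (refine k ab ij)) = spanned_verts (\<Gamma> n p ab)"
    by (simp add: spanned_verts_def image_UN)
  then show ?thesis
    using ends is_multigraph_\<Gamma>[OF ab] is_multigraph_\<Gamma>[OF refine_mem[OF ab ij]]
    unfolding surjects_onto_def multigraph_map_def
    by (intro exI[of _ \<phi>] exI[of _ id]) (simp add: verts_remove_isolated)
qed

lemma surj_orderI:
  assumes "g \<in> Hn n" "h \<in> Hn n" "H \<in> h" "G \<in> g" "surjects_onto H G"
  shows "(g, h) \<in> surj_order n"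
  using assms unfolding surj_order_def by blast

text \<open>A nonzero entry counts at least one splitting, and collapsing it is the required
  surjection. The grid of size 2n is admissible in \<open>\<pi>_eq\<close> because n \<ge> 1 gives
  2n \<ge> 2.\<close>

lemma \<pi>_nonzero_imp_surj_order:
  assumes n: "n \<ge> 1" and g: "g \<in> Hn n" and h: "h \<in> Hn n" and nz: "\<pi> n k g h \<noteq> 0"
  shows "(g, h) \<in> surj_order n"
proof -
  from Hn_representative[OF g] obtain ab where ab: "ab \<in> index_tuples n (2 * n)"
    and g_eq: "g = tilde (\<Gamma>_class n (2 * n) ab)" by blast
  have abPi: "ab \<in> {1..n} \<rightarrow> vertex_pairs (2 * n)" using ab by (simp add: index_tuples_alt PiE_def)
  have "card {ij \<in> shifts n k. tilde (\<Gamma>_class n (k * (2 * n)) (refine k ab ij)) = h} \<noteq> 0"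
    using \<pi>_eq[OF _ ab h, of k] nz n by (simp add: g_eq)
  then obtain ij where ij: "ij \<in> shifts n k" and h_eq: "tilde (\<Gamma>_class n (k * (2 * n)) (refine k ab ij)) = h"
    by (metis (mono_tags, lifting) Collect_empty_eq card.empty)
  show ?thesis
  proof (rule surj_orderI[OF g h])
    show "surjects_onto (remove_isolated (\<Gamma> n (k * (2 * n)) (refine k ab ij))) (remove_isolated (\<Gamma> n (2 * n) ab))"
      by (rule surjects_onto_remove_isolated_refine[OF abPi ij])
    show "remove_isolated (\<Gamma> n (k * (2 * n)) (refine k ab ij)) \<in> h"
      using is_multigraph_\<Gamma>[OF refine_mem[OF abPi ij]] unfolding h_eq[symmetric] \<Gamma>_class_def
      by (simp add: tilde_iso_class iso_class_self is_multigraph_remove_isolated)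
    show "remove_isolated (\<Gamma> n (2 * n) ab) \<in> g"
      using is_multigraph_\<Gamma>[OF abPi] unfolding g_eq \<Gamma>_class_def
      by (simp add: tilde_iso_class iso_class_self is_multigraph_remove_isolated)
  qed
qed

lemma \<pi>_diag_pos:
  assumes n: "n \<ge> 1" and k: "k \<ge> 1" and g: "g \<in> Hn n"
  shows "\<pi> n k g g > 0"
proof -
  from Hn_representative[OF g] obtain ab where ab: "ab \<in> index_tuples n (2 * n)"
    and g_eq: "g = tilde (\<Gamma>_class n (2 * n) ab)" by blast
  have abPi: "ab \<in> {1..n} \<rightarrow> vertex_pairs (2 * n)" using ab by (simp add: index_tuples_alt PiE_def)
  \<comment> \<open>Taking the first part of every cell splits no vertex, so it reproduces the graph
    and makes the count positive.\<close>
  define ij where "ij = (\<lambda>l\<in>{1..n}. (1::nat, 1::nat))"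
  have ij: "ij \<in> shifts n k" using k by (auto simp: ij_def shifts_def)
  have "isomorphic (remove_isolated (\<Gamma> n (2 * n) ab)) (remove_isolated (\<Gamma> n (k * (2 * n)) (refine k ab ij)))"
  proof (rule isomorphic_remove_isolatedI[where \<phi> = "\<lambda>a. subcell k a 1" and \<psi> = id])
    have "inj_on (\<lambda>a. subcell k a 1) {1..2 * n}"
      using k by (intro inj_onI) (simp add: subcell_eq_iff)
    then show "inj_on (\<lambda>a. subcell k a 1) (spanned_verts (\<Gamma> n (2 * n) ab))"
      using spanned_verts_subset[OF is_multigraph_\<Gamma>[OF abPi]] by (auto intro: inj_on_subset)
  qed (use is_multigraph_\<Gamma> refine_mem abPi ij in \<open>auto simp: refine_alt ij_def\<close>)
  then have "tilde (\<Gamma>_class n (k * (2 * n)) (refine k ab ij)) = g"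
    using is_multigraph_\<Gamma>[OF abPi] is_multigraph_\<Gamma>[OF refine_mem[OF abPi ij]]
      isomorphic_sym[OF is_multigraph_remove_isolated[OF is_multigraph_\<Gamma>[OF abPi]]]
    unfolding g_eq \<Gamma>_class_def
    by (simp add: tilde_iso_class iso_class_eq_iff is_multigraph_remove_isolated)
  then have "{ij \<in> shifts n k. tilde (\<Gamma>_class n (k * (2 * n)) (refine k ab ij)) = g} \<noteq> {}"
    using ij by blast
  then show ?thesis
    using \<pi>_eq[OF _ ab g, of k] n by (simp add: g_eq[symmetric] finite_shifts card_gt_0_iff)
qed

text \<open>The rank that drives back substitution. The choice made by \<open>SOME\<close> is
  harmless, as isomorphic graphs have equally many vertices.\<close>

definition vertex_count :: "graph_class \<Rightarrow> nat" where
  "vertex_count h = card (verts (SOME G. G \<in> h))"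

lemma vertex_count_iso_class:
  assumes "is_multigraph G" shows "vertex_count (iso_class G) = card (verts G)"
proof -
  have "(SOME H. H \<in> iso_class G) \<in> iso_class G" using iso_class_self[OF assms] by (rule someI)
  then show ?thesis unfolding vertex_count_def by (auto simp: iso_class_def isomorphic_card)
qed

lemma surj_orderE:
  assumes "(g, h) \<in> surj_order n"
  obtains G H where "is_multigraph G" "is_multigraph H" "card (edges G) = n" "card (edges H) = n"
    "g = iso_class G" "h = iso_class H" "surjects_onto H G"
proof -
  obtain G0 H0 G H where *: "is_multigraph G0" "card (edges G0) = n" "g = iso_class G0"
    "is_multigraph H0" "card (edges H0) = n" "h = iso_class H0"
    "G \<in> g" "H \<in> h" "surjects_onto H G"
    using assms unfolding surj_order_def Hn_def by auto
  then have iso: "is_multigraph G" "isomorphic G0 G" "is_multigraph H" "isomorphic H0 H"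
    by (auto simp: iso_class_def)
  with * show ?thesis by (intro that[of G H]) (auto simp: iso_class_eq_iff isomorphic_card)
qed

text \<open>Both classes have n edges. If the vertex numbers agree as well, the surjection is an
  isomorphism. Antisymmetry and the triangular shape both rest on this dichotomy.\<close>

lemma surj_order_vertex_count:
  assumes "(g, h) \<in> surj_order n" shows "g = h \<or> vertex_count g < vertex_count h"
proof -
  obtain G H where *: "is_multigraph G" "is_multigraph H" "card (edges G) = n" "card (edges H) = n"
    "g = iso_class G" "h = iso_class H" "surjects_onto H G"
    using assms by (rule surj_orderE)
  have "card (verts G) \<le> card (verts H)" using * surjects_onto_card by blast
  moreover have "h = g" if "card (verts H) = card (verts G)"
    using surjects_onto_isomorphic[of H G] that * by (simp add: iso_class_eq_iff)
  ultimately show ?thesis using * by (fastforce simp: vertex_count_iso_class)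
qed

lemma partial_order_surj_order: "partial_order_on (Hn n) (surj_order n)"
  unfolding partial_order_on_def preorder_on_def
proof (intro conjI)
  show "surj_order n \<subseteq> Hn n \<times> Hn n" by (auto simp: surj_order_def)
  show "refl_on (Hn n) (surj_order n)"
  proof (rule refl_onI)
    fix g assume g: "g \<in> Hn n"
    then obtain G where "is_multigraph G" "g = iso_class G" unfolding Hn_def by blast
    then show "(g, g) \<in> surj_order n"
      using iso_class_self isomorphic_surjects[OF isomorphic_refl] surj_orderI[OF g g] by blast
  qed
  show "trans (surj_order n)"
  proof (rule transI)
    fix f g h assume fg: "(f, g) \<in> surj_order n" and gh: "(g, h) \<in> surj_order n"
    obtain F G where F: "is_multigraph F" "is_multigraph G" "f = iso_class F" "g = iso_class G" "surjects_onto G F"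
      using fg by (rule surj_orderE)
    obtain G' H where H: "is_multigraph G'" "is_multigraph H" "g = iso_class G'" "h = iso_class H" "surjects_onto H G'"
      using gh by (rule surj_orderE)
    \<comment> \<open>The two relations supply different representatives of the middle class
      \<open>g\<close>; an isomorphism bridges them.\<close>
    have "isomorphic G' G" using F H iso_class_eq_iff by metis
    then have "surjects_onto H F"
      using F H isomorphic_surjects surjects_onto_trans by blast
    moreover have "f \<in> Hn n" "h \<in> Hn n" using fg gh by (auto simp: surj_order_def)
    ultimately show "(f, h) \<in> surj_order n"
      using F H iso_class_self surj_orderI by blast
  qed
  show "antisym (surj_order n)"
    by (rule antisymI) (metis surj_order_vertex_count less_asym)
qed

section \<open>Triangular systems, surjectivity and invertibility\<close>

lemma triangular_system_ex:
  fixes P :: "'a \<Rightarrow> 'a \<Rightarrow> real" and w :: "'a \<Rightarrow> nat"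
  assumes "finite S" "\<And>g. g \<in> S \<Longrightarrow> P g g \<noteq> 0"
    "\<And>g h. \<lbrakk>g \<in> S; h \<in> S; P g h \<noteq> 0\<rbrakk> \<Longrightarrow> g = h \<or> w g < w h"
  shows "\<exists>A. \<forall>g\<in>S. (\<Sum>h\<in>S. P g h * A h) = B g"
  using assms
\<comment> \<open>Ranking by \<open>- int (w x)\<close> adds elements by decreasing weight, so a new
  \<open>x\<close> has least weight. Its column vanishes in all earlier rows, since a nonzero entry
  would need an earlier row of weight below that of \<open>x\<close>.\<close>
proof (induction S rule: finite_ranking_induct[where f = "\<lambda>x. - int (w x)"])
  case (insert x S)
  show ?case
  proof (cases "x \<in> S")
    case True
    with insert show ?thesis by (simp add: insert_absorb)
  next
    case False
    obtain A where A: "\<forall>g\<in>S. (\<Sum>h\<in>S. P g h * A h) = B g" using insert by auto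
    \<comment> \<open>The earlier equations do not involve the unknown at \<open>x\<close>, so it
      can be solved from row \<open>x\<close>, whose diagonal entry is nonzero.\<close>
    define A' where "A' = A(x := (B x - (\<Sum>h\<in>S. P x h * A h)) / P x x)"
    have sum: "(\<Sum>h\<in>S. P g h * A' h) = (\<Sum>h\<in>S. P g h * A h)" for g
      using False by (intro sum.cong) (auto simp: A'_def)
    have "P g x = 0" if "g \<in> S" for g
      using that False insert.hyps(2)[OF that] insert.prems(2)[of g x] by fastforce
    then have "(\<Sum>h\<in>insert x S. P g h * A' h) = B g" if "g \<in> insert x S" for g
      using that False insert.hyps(1) A insert.prems(1)[of x]
      by (auto simp: sum) (simp add: A'_def)
    then show ?thesis by blast
  qed
qed auto

lemma triangular_system_unique:
  fixes P :: "'a \<Rightarrow> 'a \<Rightarrow> real" and w :: "'a \<Rightarrow> nat"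
  assumes "finite S" "\<And>g. g \<in> S \<Longrightarrow> P g g \<noteq> 0"
    "\<And>g h. \<lbrakk>g \<in> S; h \<in> S; P g h \<noteq> 0\<rbrakk> \<Longrightarrow> g = h \<or> w g < w h"
    "\<And>g. g \<in> S \<Longrightarrow> (\<Sum>h\<in>S. P g h * A h) = 0"
  shows "\<forall>h\<in>S. A h = 0"
  using assms
\<comment> \<open>With the same order of insertion, the earlier rows form a closed homogeneous
  system; once its solution is zero, row \<open>x\<close> reduces to its diagonal term.\<close>
proof (induction S rule: finite_ranking_induct[where f = "\<lambda>x. - int (w x)"])
  case (insert x S)
  show ?case
  proof (cases "x \<in> S")
    case True
    with insert show ?thesis by (simp add: insert_absorb)
  next
    case False
    have "P g x = 0" if "g \<in> S" for g
      using that False insert.hyps(2)[OF that] insert.prems(2)[of g x] by fastforce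
    then have "(\<Sum>h\<in>S. P g h * A h) = 0" if "g \<in> S" for g
      using that False insert.hyps(1) insert.prems(3)[of g] by simp
    then have S: "\<forall>h\<in>S. A h = 0" using insert by auto
    then have "P x x * A x = 0"
      using False insert.hyps(1) insert.prems(3)[of x] by simp
    with S show ?thesis using insert.prems(1)[of x] by simp
  qed
qed auto

lemma \<pi>_triangular:
  assumes "n \<ge> 1" "k \<ge> 1"
  shows "g \<in> Hn n \<Longrightarrow> real (\<pi> n k g g) \<noteq> 0"
    and "\<lbrakk>g \<in> Hn n; h \<in> Hn n; real (\<pi> n k g h) \<noteq> 0\<rbrakk> \<Longrightarrow> g = h \<or> vertex_count g < vertex_count h"
proof -
  show "g \<in> Hn n \<Longrightarrow> real (\<pi> n k g g) \<noteq> 0"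
    using \<pi>_diag_pos[OF assms, of g] by simp
  assume "g \<in> Hn n" "h \<in> Hn n" "real (\<pi> n k g h) \<noteq> 0"
  then have "(g, h) \<in> surj_order n" by (intro \<pi>_nonzero_imp_surj_order[OF assms(1)]) auto
  then show "g = h \<or> vertex_count g < vertex_count h" by (rule surj_order_vertex_count)
qed

text \<open>For small \<open>p\<close> not all of \<open>Hn n\<close> need occur, so the preimage is
  sought with support on the classes that occur at \<open>p\<close>. These occur at
  \<open>k * p\<close> too, after adding isolated vertices, and restricting rows and columns to them
  leaves a square triangular system.\<close>

lemma consistency_surj:
  assumes n: "n \<ge> 1" and k: "k \<ge> 1"
  shows "consistency n k p ` Xnp n (k * p) = Xnp n p"
proof
  show "consistency n k p ` Xnp n (k * p) \<subseteq> Xnp n p" using consistency_in_Xnp by blast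
  show "Xnp n p \<subseteq> consistency n k p ` Xnp n (k * p)"
  proof
    fix B assume B: "B \<in> Xnp n p"
    let ?S = "tilde ` Hnp n p" and ?inv = "inv_into (Hnp n p) tilde"
    have S: "?S \<subseteq> Hn n" using tilde_in_Hn by blast
    have sub: "?S \<subseteq> tilde ` Hnp n (k * p)" using k by (intro tilde_image_mono) simp
    have "\<exists>A. \<forall>g\<in>?S. (\<Sum>h\<in>?S. real (\<pi> n k g h) * A h) = B (?inv g)"
    proof (rule triangular_system_ex[where w = vertex_count])
      show "finite ?S" by (intro finite_imageI finite_Hnp)
      show "real (\<pi> n k g g) \<noteq> 0" if "g \<in> ?S" for g
        using \<pi>_triangular(1)[OF n k] subsetD[OF S that] .
      show "g = h \<or> vertex_count g < vertex_count h"
        if "g \<in> ?S" "h \<in> ?S" "real (\<pi> n k g h) \<noteq> 0" for g h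
        using \<pi>_triangular(2)[OF n k subsetD[OF S that(1)] subsetD[OF S that(2)] that(3)] .
    qed
    then obtain A where A: "\<forall>g\<in>?S. (\<Sum>h\<in>?S. real (\<pi> n k g h) * A h) = B (?inv g)" ..
    define A' where "A' h = (if h \<in> Hnp n (k * p) \<and> tilde h \<in> ?S then A (tilde h) else 0)" for h
    have "consistency n k p A' g = B g" for g
    proof (cases "g \<in> Hnp n p")
      case True
      have "consistency n k p A' g =
          (\<Sum>h\<in>Hnp n (k * p). real (\<pi> n k (tilde g) (tilde h)) * (if tilde h \<in> ?S then A (tilde h) else 0))"
        using True by (simp add: consistency_def A'_def)
      also have "\<dots> = (\<Sum>h\<in>tilde ` Hnp n (k * p). real (\<pi> n k (tilde g) h) * (if h \<in> ?S then A h else 0))"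
        by (simp add: sum.reindex inj_on_tilde)
      also have "\<dots> = (\<Sum>h\<in>?S. real (\<pi> n k (tilde g) h) * A h)"
        using sub by (intro sum.mono_neutral_cong_right) (auto simp: finite_Hnp)
      also have "\<dots> = B g" using A True by (simp add: inj_on_tilde)
      finally show ?thesis .
    next
      case False
      then show ?thesis using B by (simp add: consistency_def Xnp_def)
    qed
    then have "B = consistency n k p A'" by auto
    moreover have "A' \<in> Xnp n (k * p)" by (simp add: A'_def Xnp_def)
    ultimately show "B \<in> consistency n k p ` Xnp n (k * p)" by blast
  qed
qed

text \<open>With p \<ge> 2n both \<open>p\<close> and \<open>k * p\<close> see every class of
  \<open>Hn n\<close>, so there are as many equations as unknowns. For smaller \<open>p\<close> the
  finer grid can carry more classes than the coarser one.\<close>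

lemma consistency_inj:
  assumes n: "n \<ge> 1" and k: "k \<ge> 1" and p: "p \<ge> 2 * n"
  shows "inj_on (consistency n k p) (Xnp n (k * p))"
proof (rule inj_onI)
  fix A B assume A: "A \<in> Xnp n (k * p)" and B: "B \<in> Xnp n (k * p)"
    and eq: "consistency n k p A = consistency n k p B"
  let ?inv = "inv_into (Hnp n (k * p)) tilde"
  have "2 * n \<le> k * p" using mult_le_mono[OF k p] by simp
  then have img: "tilde ` Hnp n (k * p) = Hn n" by (rule tilde_image_eq)
  have sum: "(\<Sum>h\<in>Hn n. real (\<pi> n k g h) * (A (?inv h) - B (?inv h))) = 0" if "g \<in> Hn n" for g
  proof -
    have "g \<in> tilde ` Hnp n p" unfolding tilde_image_eq[OF p] by (rule that)
    then obtain g' where g': "g' \<in> Hnp n p" "g = tilde g'" by blast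
    have *: "(\<Sum>h\<in>Hn n. real (\<pi> n k g h) * F (?inv h)) = consistency n k p F g'" for F
      unfolding img[symmetric] sum.reindex[OF inj_on_tilde] g'(2)
      using g'(1) by (simp add: consistency_def inj_on_tilde)
    show ?thesis using *[of A] *[of B] eq by (simp add: right_diff_distrib sum_subtractf)
  qed
  have "\<forall>h\<in>Hn n. A (?inv h) - B (?inv h) = 0"
    by (rule triangular_system_unique[where w = vertex_count, OF finite_Hn \<pi>_triangular[OF n k] sum])
  then have "A h = B h" if "h \<in> Hnp n (k * p)" for h
    using that img by (metis diff_eq_diff_eq eq_iff_diff_eq_0 imageI inj_on_tilde inv_into_f_f)
  then show "A = B" using A B by (fastforce simp: Xnp_def fun_eq_iff)
qed

lemma consistency_bij:
  assumes "n \<ge> 1" "k \<ge> 1" "p \<ge> 2 * n"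
  shows "bij_betw (consistency n k p) (Xnp n (k * p)) (Xnp n p)"
  using consistency_inj consistency_surj assms by (simp add: bij_betw_def)

section \<open>The space of linearly consistent families\<close>

lemma subspace_LC: "subspace (LC n)"
  unfolding subspace_def
proof (intro conjI ballI allI)
  have "consistency n k p 0 = 0" for k p
    using consistency_scaleR[of n k p 0 0] by simp
  then show "0 \<in> LC n" by (simp add: LC_def Xnp_def)
  fix A B assume A: "A \<in> LC n" and B: "B \<in> LC n"
  from A B show "A + B \<in> LC n"
    by (auto simp: LC_def subspace_add[OF subspace_Xnp] simp flip: consistency_add)
  fix c from A show "c *\<^sub>R A \<in> LC n"
    by (auto simp: LC_def scaleR_fun_def[of c A] subspace_scale[OF subspace_Xnp] simp flip: consistency_scaleR)
qed

lemma LC_in_Xnp: "A \<in> LC n \<Longrightarrow> p \<ge> 2 \<Longrightarrow> A p \<in> Xnp n p"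
  unfolding LC_def by blast

lemma LC_consistent: "A \<in> LC n \<Longrightarrow> p \<ge> 2 \<Longrightarrow> k \<ge> 1 \<Longrightarrow> consistency n k p (A (k * p)) = A p"
  unfolding LC_def by simp

text \<open>The levels 2n and \<open>p\<close> are compared at their common multiple
  \<open>p * (2 * n)\<close>. The map from there to level 2n is injective, so the component at 2n
  fixes the one at the common multiple, and this determines the component at \<open>p\<close>. The
  map to \<open>p\<close> is only applied, never inverted.\<close>

lemma LC_eqI:
  assumes n: "n \<ge> 1" and A: "A \<in> LC n" and B: "B \<in> LC n" and eq: "A (2 * n) = B (2 * n)"
  shows "A = B"
proof
  fix p show "A p = B p"
  proof (cases "p \<ge> 2")
    case False
    then show ?thesis using A B by (simp add: LC_def)
  next
    case True
    have p2n: "p * (2 * n) \<ge> 2" using mult_le_mono[OF True, of 1 "2 * n"] n by simp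
    have *: "consistency n p (2 * n) (F (p * (2 * n))) = F (2 * n)"
      "consistency n (2 * n) p (F (p * (2 * n))) = F p"
      "F (p * (2 * n)) \<in> Xnp n (p * (2 * n))" if F: "F \<in> LC n" for F
      using LC_consistent[OF F, of "2 * n" p] LC_consistent[OF F, of p "2 * n"]
        LC_in_Xnp[OF F p2n] True n by (simp_all add: mult.commute[of p])
    have "A (p * (2 * n)) = B (p * (2 * n))"
    proof (rule inj_onD[OF consistency_inj[of n p "2 * n"]])
      show "consistency n p (2 * n) (A (p * (2 * n))) = consistency n p (2 * n) (B (p * (2 * n)))"
        using *(1)[OF A] *(1)[OF B] eq by metis
    qed (use n True *(3)[OF A] *(3)[OF B] in simp_all)
    then show ?thesis using *(2)[OF A] *(2)[OF B] by simp
  qed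
qed

text \<open>As \<open>p\<close> need not be related to 2n, \<open>B\<close> is lifted to
  \<open>D p\<close> at the common multiple \<open>p * (2 * n)\<close> and then pushed down to
  \<open>p\<close>.\<close>

lemma LC_ex:
  assumes n: "n \<ge> 1" and B: "B \<in> Xnp n (2 * n)"
  shows "\<exists>A\<in>LC n. A (2 * n) = B"
proof -
  have n2: "2 * n \<ge> 2" using n by simp
  have "\<forall>p. \<exists>D. p \<ge> 2 \<longrightarrow> D \<in> Xnp n (p * (2 * n)) \<and> consistency n p (2 * n) D = B"
  proof
    fix p
    have "B \<in> consistency n p (2 * n) ` Xnp n (p * (2 * n))" if "p \<ge> 2"
      using consistency_surj[OF n, of p "2 * n"] B that by simp
    then show "\<exists>D. p \<ge> 2 \<longrightarrow> D \<in> Xnp n (p * (2 * n)) \<and> consistency n p (2 * n) D = B" by blast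
  qed
  then obtain D where D: "\<And>p. p \<ge> 2 \<Longrightarrow> D p \<in> Xnp n (p * (2 * n))"
    "\<And>p. p \<ge> 2 \<Longrightarrow> consistency n p (2 * n) (D p) = B" by metis
  define A where "A p = (if p \<ge> 2 then consistency n (2 * n) p (D p) else 0)" for p
  \<comment> \<open>Pushed to level \<open>p * (2 * n)\<close>, \<open>D (k * p)\<close> still lies
    over \<open>B\<close> by compatibility, as does \<open>D p\<close>; injectivity of the map to
    level 2n identifies them.\<close>
  have D_cons: "consistency n k (p * (2 * n)) (D (k * p)) = D p" if p: "p \<ge> 2" and k: "k \<ge> 1" for p k
  proof -
    have kp: "k * p \<ge> 2" using mult_le_mono[OF k p] by simp
    have "consistency n p (2 * n) (consistency n k (p * (2 * n)) (D (k * p))) = B"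
      using D(2)[OF kp] consistency_comp[where p = "2 * n" and ?k1.0 = k and ?k2.0 = p and A = "D (k * p)"] n2 k p by simp
    then show ?thesis
      using inj_onD[OF consistency_inj[of n p "2 * n"]] D[OF p] consistency_in_Xnp n p by simp
  qed
  have "A \<in> LC n"
    unfolding LC_def
  proof (intro CollectI conjI allI impI)
    fix p k :: nat assume p: "p \<ge> 2" and k: "k \<ge> 1"
    have kp: "k * p \<ge> 2" using mult_le_mono[OF k p] by simp
    \<comment> \<open>There are two routes from the level of \<open>D (k * p)\<close> down to
      \<open>p\<close>: through \<open>k * p\<close>, and through \<open>2 * n * p\<close>, where
      \<open>D_cons\<close> applies.\<close>
    have "consistency n k p (A (k * p)) = consistency n ((2 * n) * k) p (D (k * p))"
      using kp p k n by (simp add: A_def consistency_comp)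
    also have "\<dots> = consistency n (2 * n) p (consistency n k (2 * n * p) (D (k * p)))"
      using consistency_comp[where p = p and ?k1.0 = k and ?k2.0 = "2 * n" and A = "D (k * p)"] p k n2 by (simp add: mult.commute)
    also have "\<dots> = A p" using D_cons[OF p k] p by (simp add: A_def mult.commute)
    finally show "A p = consistency n k p (A (k * p))" by simp
  qed (simp_all add: A_def consistency_in_Xnp)
  moreover have "A (2 * n) = B" using D(2)[OF n2] n2 by (simp add: A_def)
  ultimately show ?thesis by blast
qed

lemma sum_fun_apply: "(\<Sum>i\<in>I. f i) x = (\<Sum>i\<in>I. f i x)"
  by (induction I rule: infinite_finite_induct) auto

text \<open>Evaluation at level 2n is an isomorphism from \<open>LC n\<close> to
  \<open>Xnp n (2 * n)\<close>: surjective by \<open>LC_ex\<close>, injective by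
  \<open>LC_eqI\<close>. The families extending the point masses \<open>\<delta> h\<close> are
  therefore a basis.\<close>

lemma dim_LC:
  assumes n: "n \<ge> 1" shows "dim (LC n) = card (Hn n)"
proof -
  let ?H = "Hnp n (2 * n)"
  define \<delta> where "\<delta> h = (\<lambda>g. if g = h then 1 else (0::real))" for h :: graph_class
  have "\<forall>h\<in>?H. \<exists>A\<in>LC n. A (2 * n) = \<delta> h"
    by (intro ballI LC_ex[OF n]) (auto simp: \<delta>_def Xnp_def)
  then obtain b where b: "\<And>h. h \<in> ?H \<Longrightarrow> b h \<in> LC n" "\<And>h. h \<in> ?H \<Longrightarrow> b h (2 * n) = \<delta> h"
    by metis
  have eval: "(\<Sum>h\<in>?H. u h *\<^sub>R b h) (2 * n) g = u g" if "g \<in> ?H" for u g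
  proof -
    have "(\<Sum>h\<in>?H. u h *\<^sub>R b h) (2 * n) g = (\<Sum>h\<in>?H. if g = h then u h else 0)"
      unfolding sum_fun_apply by (intro sum.cong) (auto simp: b scaleR_fun_def \<delta>_def)
    then show ?thesis using that by (simp add: finite_Hnp)
  qed
  have inj: "inj_on b ?H"
  proof (rule inj_onI)
    fix g h assume "g \<in> ?H" "h \<in> ?H" "b g = b h"
    then have "\<delta> g g = \<delta> h g" using b(2) by metis
    then show "g = h" by (simp add: \<delta>_def split: if_splits)
  qed
  show ?thesis
  proof (rule dim_unique[where B = "b ` ?H"])
    show "b ` ?H \<subseteq> LC n" using b by blast
    show "LC n \<subseteq> span (b ` ?H)"
    proof
      fix A assume A: "A \<in> LC n"
      let ?A = "\<Sum>h\<in>?H. A (2 * n) h *\<^sub>R b h"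
      have A': "?A \<in> LC n"
        using b by (intro subspace_sum[OF subspace_LC] subspace_scale[OF subspace_LC])
      have "A (2 * n) = ?A (2 * n)"
      proof
        fix g show "A (2 * n) g = ?A (2 * n) g"
        proof (cases "g \<in> ?H")
          case True
          then show ?thesis by (rule eval[symmetric])
        next
          case False
          then have "F (2 * n) g = 0" if "F \<in> LC n" for F
            using LC_in_Xnp[OF that, of "2 * n"] n by (simp add: Xnp_def)
          from this[OF A] this[OF A'] show ?thesis by (rule trans[OF _ sym])
        qed
      qed
      then have "A = ?A" by (rule LC_eqI[OF n A A'])
      moreover have "?A \<in> span (b ` ?H)" by (intro span_sum span_scale span_base) blast
      ultimately show "A \<in> span (b ` ?H)" by simp
    qed
    show "independent (b ` ?H)"
    proof (rule independent_if_scalars_zero)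
      fix f x assume 0: "(\<Sum>x\<in>b ` ?H. f x *\<^sub>R x) = 0" and "x \<in> b ` ?H"
      then obtain h where h: "h \<in> ?H" "x = b h" by blast
      have "(\<Sum>h\<in>?H. f (b h) *\<^sub>R b h) = 0" using 0 by (simp add: sum.reindex[OF inj])
      then show "f x = 0" using eval[OF h(1), of "\<lambda>h. f (b h)"] h by simp
    qed (simp add: finite_Hnp)
    show "card (b ` ?H) = card (Hn n)" by (simp add: card_image[OF inj] card_Hnp)
  qed
qed

section \<open>Step functions and exchanges of cells\<close>

lemma mem_cell_iff: "p \<ge> 1 \<Longrightarrow> x \<in> cell p a \<longleftrightarrow> real a - 1 < real p * x \<and> real p * x \<le> real a"
  by (auto simp: cell_def field_simps)

lemma cell_unique:
  assumes "p \<ge> 1" "x \<in> cell p a" "x \<in> cell p b" shows "a = b"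
  using assms by (simp add: mem_cell_iff)

lemma cell_subset:
  assumes p: "p \<ge> 1" and "a \<in> {1..p}" shows "cell p a \<subseteq> {0<..1}"
proof
  fix x assume "x \<in> cell p a"
  then have *: "real a - 1 < real p * x" "real p * x \<le> real a" using assms by (auto simp: mem_cell_iff)
  have "real a \<ge> 1" "real a \<le> real p" using assms by auto
  with * have "0 < real p * x" "real p * x \<le> real p * 1" by linarith+
  then show "x \<in> {0<..1}" using p by (simp add: zero_less_mult_iff)
qed

text \<open>The index is the ceiling of \<open>real p * x\<close>. Cells are open on the left, so 0
  lies in none of them; below, this point is treated separately.\<close>

lemma cell_cover:
  assumes "p \<ge> 1" "x \<in> {0<..1}"
  obtains a where "a \<in> {1..p}" "x \<in> cell p a"
proof
  have *: "0 < real p * x" "real p * x \<le> real p" using assms by (auto simp: mult_le_cancel_left1)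
  have c: "\<lceil>real p * x\<rceil> > 0" "\<lceil>real p * x\<rceil> \<le> int p"
    using *(1) unfolding zero_less_ceiling ceiling_le_iff using *(2) by simp_all
  then have "1 \<le> nat \<lceil>real p * x\<rceil>" "nat \<lceil>real p * x\<rceil> \<le> p" by linarith+
  then show "nat \<lceil>real p * x\<rceil> \<in> {1..p}" by simp
  have "real (nat \<lceil>real p * x\<rceil>) = of_int \<lceil>real p * x\<rceil>" using c by simp
  then show "x \<in> cell p (nat \<lceil>real p * x\<rceil>)"
    unfolding mem_cell_iff[OF assms(1)] using ceiling_correct[of "real p * x"] by simp
qed

lemma cell_borel [measurable]: "cell p a \<in> sets borel"
  by (simp add: cell_def)

lemma ep_commute: "ep p (a, b) = ep p (b, a)"
  by (auto simp: ep_def)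

text \<open>Since a \<noteq> b, the two rectangles are disjoint, so the sum of their indicators is
  at most 1.\<close>

lemma ep_graphon:
  assumes p: "p \<ge> 1" and ab: "(a, b) \<in> vertex_pairs p"
  shows "ep p (a, b) \<in> graphons"
  unfolding graphons_def
proof (intro CollectI conjI allI ballI impI)
  have "ep p (a, b) \<in> borel_measurable lborel"
    unfolding ep_def split_conv
    by (intro borel_measurable_add borel_measurable_indicator) (simp_all add: borel_Times)
  then have "ep p (a, b) \<in> borel_measurable lebesgue"
    by (rule measurable_completion)
  then show "ep p (a, b) \<in> borel_measurable (lebesgue_on ({0..1} \<times> {0..1}))"
    by (rule measurable_restrict_space1)
  show "ep p (a, b) (x, y) = ep p (a, b) (y, x)" for x y
    by (auto simp: ep_def indicator_def)
  show "ep p (a, b) z \<in> {0..1}" for z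
    using ab cell_unique[OF p] by (cases z) (auto simp: ep_def indicator_def vertex_pairs_def)
  show "ep p (a, b) z = 0" if "z \<notin> {0..1} \<times> {0..1}" for z
  proof -
    have "a \<in> {1..p}" "b \<in> {1..p}" using ab by (auto simp: vertex_pairs_def)
    moreover have "cell p c \<subseteq> {0..1}" if "c \<in> {1..p}" for c
      using cell_subset[OF p that] by (rule order_trans) auto
    ultimately have "cell p a \<subseteq> {0..1}" "cell p b \<subseteq> {0..1}" by blast+
    then have "cell p a \<times> cell p b \<subseteq> {0..1} \<times> {0..1}" "cell p b \<times> cell p a \<subseteq> {0..1} \<times> {0..1}"
      by (simp_all only: Sigma_mono)
    from contra_subsetD[OF this(1) that] contra_subsetD[OF this(2) that]
    show ?thesis by (simp add: ep_def)
  qed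
qed

lemma Ep_alt: "Ep p = ep p ` vertex_pairs p"
proof
  show "Ep p \<subseteq> ep p ` vertex_pairs p" by (auto simp: Ep_def vertex_pairs_def)
  show "ep p ` vertex_pairs p \<subseteq> Ep p"
  proof (rule image_subsetI, clarify)
    fix a b assume "(a, b) \<in> vertex_pairs p"
    then consider "1 \<le> a" "a < b" "b \<le> p" | "1 \<le> b" "b < a" "a \<le> p"
      by (fastforce simp: vertex_pairs_def)
    then show "ep p (a, b) \<in> Ep p"
    proof cases
      case 1
      then show ?thesis unfolding Ep_def by blast
    next
      case 2
      then have "ep p (b, a) \<in> Ep p" unfolding Ep_def by blast
      then show ?thesis by (simp only: ep_commute[of p a b])
    qed
  qed
qed

lemma cell_eq_UN_subcells:
  assumes p: "p \<ge> 1" and k: "k \<ge> 1" and a: "a \<ge> 1"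
  shows "cell p a = (\<Union>i\<in>{1..k}. cell (k * p) (subcell k a i))"
proof -
  have kp: "k * p \<ge> 1" using p k by (metis mult_le_mono nat_mult_1)
  show ?thesis
  proof (intro equalityI subsetI)
    fix x assume "x \<in> cell p a"
    then have *: "real a - 1 < real p * x" "real p * x \<le> real a" using p by (auto simp: mem_cell_iff)
    \<comment> \<open>\<open>c\<close> is the position of \<open>x\<close> inside cell
      \<open>a\<close>: the distance from the left end, measured in cells of the finer grid and
      rounded up.\<close>
    define c where "c = \<lceil>real k * (real p * x) - real k * (real a - 1)\<rceil>"
    have "real k * (real a - 1) < real k * (real p * x)" "real k * (real p * x) \<le> real k * real a"
      using * k by auto
    then have c: "c > 0" "c \<le> int k"
      by (simp_all add: c_def ceiling_le_iff algebra_simps)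
    have "x \<in> cell (k * p) (subcell k a (nat c))"
      unfolding mem_cell_iff[OF kp]
    proof -
      have "real (subcell k a (nat c)) = real k * (real a - 1) + of_int c"
        using c a by (simp add: subcell_def of_nat_diff)
      moreover have "of_int c - 1 < real k * (real p * x) - real k * (real a - 1)"
        "real k * (real p * x) - real k * (real a - 1) \<le> of_int c"
        unfolding c_def by linarith+
      ultimately show "real (subcell k a (nat c)) - 1 < real (k * p) * x \<and>
          real (k * p) * x \<le> real (subcell k a (nat c))"
        by (simp add: mult.assoc)
    qed
    moreover have "nat c \<in> {1..k}" using c by auto
    ultimately show "x \<in> (\<Union>i\<in>{1..k}. cell (k * p) (subcell k a i))" by blast
  next
    fix x assume "x \<in> (\<Union>i\<in>{1..k}. cell (k * p) (subcell k a i))"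
    then obtain i where i: "i \<in> {1..k}" "x \<in> cell (k * p) (subcell k a i)" by blast
    have "real (subcell k a i) = real k * (real a - 1) + real i"
      using a by (simp add: subcell_def of_nat_diff)
    then have "real k * (real a - 1) + real i - 1 < real k * (real p * x)"
      "real k * (real p * x) \<le> real k * (real a - 1) + real i"
      using i mem_cell_iff[OF kp] by (auto simp: mult.assoc)
    moreover have "1 \<le> real i" "real i \<le> real k" using i by auto
    moreover have "real k * real a = real k * (real a - 1) + real k" by (simp add: algebra_simps)
    ultimately have "real k * (real a - 1) < real k * (real p * x)" "real k * (real p * x) \<le> real k * real a"
      by linarith+
    then show "x \<in> cell p a" using k p by (simp add: mem_cell_iff)
  qed
qed

lemma indicator_cell_subcells:
  assumes p: "p \<ge> 1" and k: "k \<ge> 1" and a: "a \<ge> 1"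
  shows "indicat_real (cell p a) x = (\<Sum>i\<in>{1..k}. indicat_real (cell (k * p) (subcell k a i)) x)"
proof -
  have kp: "k * p \<ge> 1" using p k by (metis mult_le_mono nat_mult_1)
  have "disjoint_family_on (\<lambda>i. cell (k * p) (subcell k a i)) {1..k}"
    unfolding disjoint_family_on_def
    using cell_unique[OF kp] subcell_eq_iff[OF a a] by blast
  from indicator_UN_disjoint[OF _ this] show ?thesis
    by (simp add: cell_eq_UN_subcells[OF assms])
qed

text \<open>Both indicators factor over the coordinates and each factor is a sum over parts, so each
  product is a double sum. For the reversed rectangle the summations come in the other order, hence
  \<open>sum.swap\<close>.\<close>

lemma ep_subcells:
  assumes p: "p \<ge> 1" and k: "k \<ge> 1" and a: "a \<ge> 1" and b: "b \<ge> 1"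
  shows "ep p (a, b) = (\<Sum>s\<in>{1..k} \<times> {1..k}. ep (k * p) (subcell k a (fst s), subcell k b (snd s)))"
proof
  fix z :: "real \<times> real"
  obtain x y where z: "z = (x, y)" by fastforce
  have ind: "indicat_real (A \<times> B) (x, y) = indicat_real A x * indicat_real B y" for A B
    by (simp add: indicator_def)
  have sum_apply: "(\<Sum>i\<in>I. f i) z = (\<Sum>i\<in>I. f i z)" for I :: "(nat \<times> nat) set" and f :: "nat \<times> nat \<Rightarrow> kernel"
    by (induction I rule: infinite_finite_induct) auto
  have "ep p (a, b) z = (\<Sum>i\<in>{1..k}. \<Sum>j\<in>{1..k}. ep (k * p) (subcell k a i, subcell k b j) z)"
    unfolding ep_def z split_conv ind indicator_cell_subcells[OF p k a] indicator_cell_subcells[OF p k b]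
      sum_product sum.distrib add_left_cancel by (rule sum.swap)
  then show "ep p (a, b) z = (\<Sum>s\<in>{1..k} \<times> {1..k}. ep (k * p) (subcell k a (fst s), subcell k b (snd s))) z"
    by (simp add: sum_apply sum.cartesian_product split_def)
qed

text \<open>Translates cell \<open>a\<close> onto cell \<open>\<phi> a\<close>; the ceiling finds
  the cell that contains \<open>x\<close>. The point 0 is in no cell and is fixed, so a permutation
  \<open>\<phi>\<close> yields a bijection of the closed interval.\<close>

definition cell_exchange :: "nat \<Rightarrow> (nat \<Rightarrow> nat) \<Rightarrow> real \<Rightarrow> real" where
  "cell_exchange p \<phi> x = (if x \<in> {0<..1}
     then let a = nat \<lceil>real p * x\<rceil> in x + (real (\<phi> a) - real a) / real p else x)"

lemma cell_exchange_cell: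
  assumes p: "p \<ge> 1" and a: "a \<in> {1..p}" and x: "x \<in> cell p a"
  shows "cell_exchange p \<phi> x = x + (real (\<phi> a) - real a) / real p"
proof -
  have "\<lceil>real p * x\<rceil> = int a"
    using x p by (intro ceiling_unique) (auto simp: mem_cell_iff)
  moreover have "x \<in> {0<..1}" using cell_subset[OF p a] x by blast
  ultimately show ?thesis by (simp add: cell_exchange_def)
qed

lemma cell_translate:
  assumes p: "p \<ge> 1"
  shows "x + (real b - real a) / real p \<in> cell p b \<longleftrightarrow> x \<in> cell p a"
proof -
  have "real p * (x + (real b - real a) / real p) = real p * x + real b - real a"
    using p by (simp add: field_simps)
  then show ?thesis unfolding mem_cell_iff[OF p] by linarith
qed

text \<open>An equivalence, so that the indicator of cell \<open>\<phi> a\<close> pulls back exactly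
  to that of cell \<open>a\<close>.\<close>

lemma cell_exchange_mem_cell:
  assumes p: "p \<ge> 1" and \<phi>: "bij_betw \<phi> {1..p} {1..p}" and a: "a \<in> {1..p}" and x: "x \<in> {0..1}"
  shows "cell_exchange p \<phi> x \<in> cell p (\<phi> a) \<longleftrightarrow> x \<in> cell p a"
proof (cases "x \<in> {0<..1}")
  case True
  then obtain c where c: "c \<in> {1..p}" "x \<in> cell p c" using p by (elim cell_cover[rotated])
  have "cell_exchange p \<phi> x \<in> cell p (\<phi> c)"
    using c p by (simp add: cell_exchange_cell cell_translate)
  then have "cell_exchange p \<phi> x \<in> cell p (\<phi> a) \<longleftrightarrow> \<phi> a = \<phi> c" using cell_unique[OF p] by metis
  also have "\<dots> \<longleftrightarrow> a = c" using \<phi> a c by (auto simp: bij_betw_def inj_on_eq_iff)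
  also have "\<dots> \<longleftrightarrow> x \<in> cell p a" using cell_unique[OF p] c by metis
  finally show ?thesis .
next
  case False
  have "\<phi> a \<in> {1..p}" using \<phi> a by (auto dest: bij_betwE)
  then have "x \<notin> cell p (\<phi> a)" "x \<notin> cell p a"
    using False a cell_subset[OF p] by blast+
  moreover have "cell_exchange p \<phi> x = x" using False by (auto simp: cell_exchange_def)
  ultimately show ?thesis by simp
qed

text \<open>Stated for a left inverse \<open>\<phi>'\<close> so that it can be applied again with
  the two roles exchanged, which gives both halves of bijectivity.\<close>

lemma cell_exchange_inverse:
  assumes p: "p \<ge> 1" and \<phi>: "bij_betw \<phi> {1..p} {1..p}"
    and inv: "\<And>a. a \<in> {1..p} \<Longrightarrow> \<phi>' (\<phi> a) = a" and x: "x \<in> {0..1}"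
  shows "cell_exchange p \<phi> x \<in> {0..1}" "cell_exchange p \<phi>' (cell_exchange p \<phi> x) = x"
proof -
  have "cell_exchange p \<phi> x \<in> {0..1} \<and> cell_exchange p \<phi>' (cell_exchange p \<phi> x) = x"
  proof (cases "x \<in> {0<..1}")
    case True
    then obtain a where a: "a \<in> {1..p}" "x \<in> cell p a" using p by (elim cell_cover[rotated])
    have \<phi>a: "\<phi> a \<in> {1..p}" using \<phi> a by (auto dest: bij_betwE)
    have eq: "cell_exchange p \<phi> x = x + (real (\<phi> a) - real a) / real p"
      by (rule cell_exchange_cell[OF p a])
    then have mem: "cell_exchange p \<phi> x \<in> cell p (\<phi> a)" using a p by (simp add: cell_translate)
    then have "cell_exchange p \<phi>' (cell_exchange p \<phi> x) =
        cell_exchange p \<phi> x + (real (\<phi>' (\<phi> a)) - real (\<phi> a)) / real p"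
      by (rule cell_exchange_cell[OF p \<phi>a])
    also have "\<dots> = x" using inv[OF a(1)] by (simp add: eq field_simps flip: add_divide_distrib)
    finally show ?thesis using mem cell_subset[OF p \<phi>a] by auto
  next
    case False
    then show ?thesis using x by (simp add: cell_exchange_def)
  qed
  then show "cell_exchange p \<phi> x \<in> {0..1}" "cell_exchange p \<phi>' (cell_exchange p \<phi> x) = x" by auto
qed

lemma bij_betw_cell_exchange:
  assumes p: "p \<ge> 1" and \<phi>: "bij_betw \<phi> {1..p} {1..p}"
  shows "bij_betw (cell_exchange p \<phi>) {0..1} {0..1}"
proof -
  let ?\<phi> = "inv_into {1..p} \<phi>"
  note 1 = cell_exchange_inverse[OF p \<phi> bij_betw_inv_into_left[OF \<phi>]]
  note 2 = cell_exchange_inverse[OF p bij_betw_inv_into[OF \<phi>] bij_betw_inv_into_right[OF \<phi>]]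
  show ?thesis
    by (rule bij_betw_byWitness[where f' = "cell_exchange p ?\<phi>"])
      (use 1 2 in \<open>blast+\<close>)
qed

text \<open>The cells cover all of the interval but the null set {0}.\<close>

lemma emeasure_lebesgue_cells:
  assumes p: "p \<ge> 1" and B: "B \<in> sets lebesgue" "B \<subseteq> {0..1}"
  shows "emeasure lebesgue B = (\<Sum>a\<in>{1..p}. emeasure lebesgue (B \<inter> cell p a))"
proof -
  have cells: "cell p a \<in> sets lebesgue" for a by simp
  have UN: "(\<Union>a\<in>{1..p}. B \<inter> cell p a) = B - {0}"
  proof (intro equalityI subsetI)
    fix x assume "x \<in> (\<Union>a\<in>{1..p}. B \<inter> cell p a)"
    then show "x \<in> B - {0}" using cell_subset[OF p] by fastforce
  next
    fix x assume "x \<in> B - {0}"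
    then have "x \<in> B" "x \<in> {0<..1}" using B by fastforce+
    then show "x \<in> (\<Union>a\<in>{1..p}. B \<inter> cell p a)" using cell_cover[OF p] by blast
  qed
  have "(\<Sum>a\<in>{1..p}. emeasure lebesgue (B \<inter> cell p a)) = emeasure lebesgue (\<Union>a\<in>{1..p}. B \<inter> cell p a)"
    using B cells cell_unique[OF p] by (intro sum_emeasure) (auto simp: disjoint_family_on_def)
  also have "\<dots> = emeasure lebesgue (B - {0})" by (simp only: UN)
  also have "\<dots> = emeasure lebesgue B"
    using B by (intro emeasure_Diff_null_set) auto
  finally show ?thesis by simp
qed

text \<open>A preimage is cut along the cells: in cell \<open>a\<close> it is a translate of the
  part of \<open>A\<close> in cell \<open>\<phi> a\<close>, and the point 0 is kept. Translations
  preserve measurability and measure, and \<open>\<phi>\<close> only permutes the terms of the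
  sum.\<close>

lemma cell_exchange_mp:
  assumes p: "p \<ge> 1" and \<phi>: "bij_betw \<phi> {1..p} {1..p}"
  shows "cell_exchange p \<phi> \<in> mp_bijections"
proof -
  let ?\<sigma> = "cell_exchange p \<phi>" and ?L = "lebesgue_on {0..1::real}"
  note bij = bij_betw_cell_exchange[OF p \<phi>]
  have cells: "cell p a \<in> sets lebesgue" for a by simp
  have \<phi>_mem: "\<phi> a \<in> {1..p}" if "a \<in> {1..p}" for a using \<phi> that by (auto dest: bij_betwE)
  have pre: "?\<sigma> -` A \<inter> {0..1} \<in> sets lebesgue"
    "emeasure lebesgue (?\<sigma> -` A \<inter> {0..1}) = emeasure lebesgue A"
    if A: "A \<in> sets lebesgue" "A \<subseteq> {0..1}" for A
  proof -
    let ?B = "?\<sigma> -` A \<inter> {0..1}" and ?t = "\<lambda>a. - ((real (\<phi> a) - real a) / real p)"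
    have piece: "?B \<inter> cell p a = (\<lambda>x. ?t a + x) ` (A \<inter> cell p (\<phi> a))" if a: "a \<in> {1..p}" for a
    proof (intro equalityI subsetI)
      fix x assume x: "x \<in> ?B \<inter> cell p a"
      then have "?\<sigma> x \<in> A \<inter> cell p (\<phi> a)" using cell_exchange_mem_cell[OF p \<phi> a] by auto
      moreover have "x = ?t a + ?\<sigma> x" using cell_exchange_cell[OF p a, of x] x by simp
      ultimately show "x \<in> (\<lambda>x. ?t a + x) ` (A \<inter> cell p (\<phi> a))" by blast
    next
      fix x assume "x \<in> (\<lambda>x. ?t a + x) ` (A \<inter> cell p (\<phi> a))"
      then have y: "x + (real (\<phi> a) - real a) / real p \<in> A \<inter> cell p (\<phi> a)" by auto
      then have x: "x \<in> cell p a" using cell_translate[OF p] by blast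
      then have "?\<sigma> x \<in> A" using y cell_exchange_cell[OF p a, of x] by simp
      moreover have "x \<in> {0..1}" using x cell_subset[OF p a] by fastforce
      ultimately show "x \<in> ?B \<inter> cell p a" using x by simp
    qed
    have "?B = (A \<inter> {0}) \<union> (\<Union>a\<in>{1..p}. ?B \<inter> cell p a)"
    proof (intro equalityI subsetI)
      fix x assume x: "x \<in> ?B"
      show "x \<in> (A \<inter> {0}) \<union> (\<Union>a\<in>{1..p}. ?B \<inter> cell p a)"
      proof (cases "x = 0")
        case True
        with x show ?thesis by (simp add: cell_exchange_def)
      next
        case False
        then have "x \<in> {0<..1}" using x by auto
        then show ?thesis using x cell_cover[OF p] by blast
      qed
    qed (auto simp: cell_exchange_def)
    also have "\<dots> \<in> sets lebesgue"
    proof (intro sets.Un sets.finite_UN)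
      show "A \<inter> {0} \<in> sets lebesgue" using A by (intro sets.Int) auto
      show "?B \<inter> cell p a \<in> sets lebesgue" if "a \<in> {1..p}" for a
        unfolding piece[OF that] by (intro lebesgue_sets_translation sets.Int A cells)
    qed simp
    finally show B: "?B \<in> sets lebesgue" .
    have "emeasure lebesgue ?B = (\<Sum>a\<in>{1..p}. emeasure lebesgue (?B \<inter> cell p a))"
      by (intro emeasure_lebesgue_cells[OF p B]) auto
    also have "\<dots> = (\<Sum>a\<in>{1..p}. emeasure lebesgue (A \<inter> cell p (\<phi> a)))"
    proof (rule sum.cong[OF refl])
      fix a assume "a \<in> {1..p}"
      then show "emeasure lebesgue (?B \<inter> cell p a) = emeasure lebesgue (A \<inter> cell p (\<phi> a))"
        using emeasure_lebesgue_affine[of 1 "?t a" "A \<inter> cell p (\<phi> a)"] by (simp add: piece add.commute)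
    qed
    also have "\<dots> = (\<Sum>a\<in>{1..p}. emeasure lebesgue (A \<inter> cell p a))"
      by (rule sum.reindex_bij_betw[OF \<phi>])
    also have "\<dots> = emeasure lebesgue A" by (rule emeasure_lebesgue_cells[OF p A, symmetric])
    finally show "emeasure lebesgue ?B = emeasure lebesgue A" .
  qed
  have sets_L: "A \<in> sets ?L \<longleftrightarrow> A \<in> sets lebesgue \<and> A \<subseteq> {0..1}" for A
    by (subst sets_restrict_space_iff) auto
  have meas: "?\<sigma> \<in> ?L \<rightarrow>\<^sub>M ?L"
  proof (rule measurableI)
    show "?\<sigma> x \<in> space ?L" if "x \<in> space ?L" for x
      using that bij_betwE[OF bij] by simp
    show "?\<sigma> -` A \<inter> space ?L \<in> sets ?L" if "A \<in> sets ?L" for A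
      using that pre(1)[of A] by (auto simp: sets_L)
  qed
  moreover have "distr ?L ?L ?\<sigma> = ?L"
  proof (rule measure_eqI)
    fix A assume "A \<in> sets (distr ?L ?L ?\<sigma>)"
    then have A: "A \<in> sets ?L" by simp
    then have A': "A \<in> sets lebesgue" "A \<subseteq> {0..1}" by (simp_all add: sets_L)
    have "emeasure (distr ?L ?L ?\<sigma>) A = emeasure ?L (?\<sigma> -` A \<inter> {0..1})"
      using emeasure_distr[OF meas A] by simp
    also have "\<dots> = emeasure lebesgue (?\<sigma> -` A \<inter> {0..1})" by (intro emeasure_restrict_space) auto
    also have "\<dots> = emeasure lebesgue A" by (rule pre(2)[OF A'])
    also have "\<dots> = emeasure ?L A" using A' by (intro emeasure_restrict_space[symmetric]) auto
    finally show "emeasure (distr ?L ?L ?\<sigma>) A = emeasure ?L A" .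
  qed simp
  ultimately show ?thesis using bij by (simp add: mp_bijections_def)
qed

text \<open>The action is by pullback, so the indices \<open>\<phi> a\<close> and
  \<open>\<phi> b\<close> stand on the function acted upon.\<close>

lemma act_cell_exchange_ep:
  assumes p: "p \<ge> 1" and \<phi>: "bij_betw \<phi> {1..p} {1..p}" and ab: "(a, b) \<in> vertex_pairs p"
  shows "act (cell_exchange p \<phi>) (ep p (\<phi> a, \<phi> b)) = ep p (a, b)"
proof
  fix z :: "real \<times> real"
  obtain x y where z: "z = (x, y)" by fastforce
  show "act (cell_exchange p \<phi>) (ep p (\<phi> a, \<phi> b)) z = ep p (a, b) z"
  proof (cases "x \<in> {0..1} \<and> y \<in> {0..1}")
    case True
    then show ?thesis
      using ab cell_exchange_mem_cell[OF p \<phi>] by (simp add: act_def z ep_def indicator_def vertex_pairs_def)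
  next
    case False
    then have "ep p (a, b) (x, y) = 0" using ep_graphon[OF p ab] by (auto simp: graphons_def)
    then show ?thesis using False by (simp only: act_def z split_conv if_False)
  qed
qed

section \<open>Multilinear functionals on step functions\<close>

lemma multilinear_on_sum:
  assumes M: "multilinear_on n V M" and V: "subspace V" and x: "x \<in> {1..n} \<rightarrow>\<^sub>E V"
    and i: "i \<in> {1..n}" and F: "\<And>s. s \<in> S \<Longrightarrow> F s \<in> V"
  shows "M (x(i := \<Sum>s\<in>S. F s)) = (\<Sum>s\<in>S. M (x(i := F s)))"
proof -
  have lin: "M (x(i := c *\<^sub>R f + d *\<^sub>R g)) = c * M (x(i := f)) + d * M (x(i := g))"
    if "f \<in> V" "g \<in> V" for c d f g
    using M x i that unfolding multilinear_on_def by blast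
  \<comment> \<open>Settles the empty sum, and the case of infinite \<open>S\<close>, where the sum
    is 0 by convention.\<close>
  have 0: "M (x(i := 0)) = 0"
    using lin[of 0 0 0 0] subspace_0[OF V] by simp
  show ?thesis
    using F
  proof (induction S rule: infinite_finite_induct)
    case (insert s S)
    have "sum F S \<in> V" using insert.prems by (intro subspace_sum[OF V]) auto
    then have "M (x(i := F s + sum F S)) = M (x(i := F s)) + M (x(i := sum F S))"
      using lin[of "F s" "sum F S" 1 1] insert.prems by simp
    also have "M (x(i := sum F S)) = (\<Sum>s\<in>S. M (x(i := F s)))"
      using insert.prems by (intro insert.IH) auto
    finally show ?case by (simp only: sum.insert[OF insert.hyps])
  qed (use 0 in simp_all)
qed

text \<open>Coordinates are expanded one at a time: those in \<open>J\<close> are expanded already,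
  the others are carried by \<open>g\<close>. This \<open>g\<close> is quantified inside the
  induction, because expanding coordinate \<open>i\<close> calls the hypothesis for \<open>g\<close>
  changed at \<open>i\<close>.\<close>

lemma multilinear_on_sum_all:
  assumes M: "multilinear_on n V M" and V: "subspace V" and S: "finite S"
    and f: "\<And>l s. l \<in> {1..n} \<Longrightarrow> s \<in> S \<Longrightarrow> f l s \<in> V"
  shows "M (\<lambda>l\<in>{1..n}. \<Sum>s\<in>S. f l s) = (\<Sum>t\<in>{1..n} \<rightarrow>\<^sub>E S. M (\<lambda>l\<in>{1..n}. f l (t l)))"
proof -
  have "\<forall>g\<in>{1..n} \<rightarrow>\<^sub>E V. M (\<lambda>l\<in>{1..n}. if l \<in> J then \<Sum>s\<in>S. f l s else g l) =
      (\<Sum>t\<in>J \<rightarrow>\<^sub>E S. M (\<lambda>l\<in>{1..n}. if l \<in> J then f l (t l) else g l))"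
    if "finite J" "J \<subseteq> {1..n}" for J
    using that
  proof (induction J rule: finite_induct)
    case empty
    show ?case by simp
  next
    case (insert i J)
    then have i: "i \<in> {1..n}" by blast
    show ?case
    proof
      fix g assume g: "g \<in> {1..n} \<rightarrow>\<^sub>E V"
      let ?x = "\<lambda>l\<in>{1..n}. if l \<in> J then \<Sum>s\<in>S. f l s else g l"
      have x: "?x \<in> {1..n} \<rightarrow>\<^sub>E V"
        unfolding restrict_PiE_iff using f PiE_mem[OF g] by (auto intro!: subspace_sum[OF V])
      have upd: "(\<lambda>l\<in>{1..n}. if l \<in> J then \<Sum>s\<in>S. f l s else (g(i := v)) l) = ?x(i := v)" for v
        using i insert.hyps(2) by (auto simp: fun_eq_iff restrict_def)
      have "M (\<lambda>l\<in>{1..n}. if l \<in> insert i J then \<Sum>s\<in>S. f l s else g l) = M (?x(i := \<Sum>s\<in>S. f i s))"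
        using i by (intro arg_cong[where f = M]) (auto simp: fun_eq_iff restrict_def)
      also have "\<dots> = (\<Sum>s\<in>S. M (?x(i := f i s)))"
        by (rule multilinear_on_sum[OF M V x i f[OF i]])
      also have "\<dots> = (\<Sum>s\<in>S. \<Sum>t\<in>J \<rightarrow>\<^sub>E S. M (\<lambda>l\<in>{1..n}. if l \<in> insert i J then f l ((t(i := s)) l) else g l))"
      proof (rule sum.cong[OF refl])
        fix s assume s: "s \<in> S"
        have "g(i := f i s) \<in> {1..n} \<rightarrow>\<^sub>E V"
          using g i f[OF i s] by (auto simp: PiE_iff extensional_def)
        then have "M (?x(i := f i s)) =
            (\<Sum>t\<in>J \<rightarrow>\<^sub>E S. M (\<lambda>l\<in>{1..n}. if l \<in> J then f l (t l) else (g(i := f i s)) l))"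
          using insert.IH insert.prems unfolding upd[symmetric] by blast
        also have "\<dots> = (\<Sum>t\<in>J \<rightarrow>\<^sub>E S. M (\<lambda>l\<in>{1..n}. if l \<in> insert i J then f l ((t(i := s)) l) else g l))"
          using insert.hyps(2) by (intro sum.cong refl arg_cong[where f = M]) (auto simp: fun_eq_iff restrict_def)
        finally show "M (?x(i := f i s)) = \<dots>" .
      qed
      also have "\<dots> = (\<Sum>t\<in>insert i J \<rightarrow>\<^sub>E S. M (\<lambda>l\<in>{1..n}. if l \<in> insert i J then f l (t l) else g l))"
        \<comment> \<open>A function on \<open>insert i J\<close> is a value at \<open>i\<close>
          together with a function on \<open>J\<close>.\<close>
        unfolding PiE_insert_eq sum.reindex[OF inj_combinator[OF insert.hyps(2), of "\<lambda>_. S"]] sum.cartesian_product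
        by (simp add: split_def)
      finally show "M (\<lambda>l\<in>{1..n}. if l \<in> insert i J then \<Sum>s\<in>S. f l s else g l) = \<dots>" .
    qed
  qed
  from this[of "{1..n}"] have all: "\<forall>g\<in>{1..n} \<rightarrow>\<^sub>E V.
      M (\<lambda>l\<in>{1..n}. if l \<in> {1..n} then \<Sum>s\<in>S. f l s else g l) =
      (\<Sum>t\<in>{1..n} \<rightarrow>\<^sub>E S. M (\<lambda>l\<in>{1..n}. if l \<in> {1..n} then f l (t l) else g l))"
    by simp
  have "(\<lambda>l\<in>{1..n}. 0) \<in> {1..n} \<rightarrow>\<^sub>E V"
    unfolding restrict_PiE_iff using subspace_0[OF V] by simp
  note all = bspec[OF all this]
  have if_restrict: "(\<lambda>l\<in>{1..n}. if l \<in> {1..n} then h l else h' l) = (\<lambda>l\<in>{1..n}. h l)"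
    for h h' :: "nat \<Rightarrow> kernel"
    by (intro restrict_ext) (rule if_P)
  show ?thesis using all unfolding if_restrict .
qed

text \<open>Coordinates are released from \<open>B\<close> to \<open>span B\<close> one at a time;
  in a single coordinate, the vectors where \<open>M\<close> and \<open>M'\<close> agree form a
  subspace containing \<open>B\<close>.\<close>

lemma multilinear_on_span_eqI:
  assumes M: "multilinear_on n V M" and M': "multilinear_on n V M'" and V: "subspace V" and B: "B \<subseteq> V"
    and eq: "\<And>x. x \<in> {1..n} \<rightarrow>\<^sub>E B \<Longrightarrow> M x = M' x" and x: "x \<in> {1..n} \<rightarrow>\<^sub>E span B"
  shows "M x = M' x"
proof -
  have BV: "span B \<subseteq> V" using B V by (rule span_minimal)
  have "\<forall>x\<in>{1..n} \<rightarrow>\<^sub>E V. (\<forall>l\<in>{1..n}. x l \<in> (if l \<in> J then span B else B)) \<longrightarrow> M x = M' x"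
    if "finite J" "J \<subseteq> {1..n}" for J
    using that
  proof (induction J rule: finite_induct)
    case empty
    then show ?case using eq by (auto simp: PiE_iff)
  next
    case (insert i J)
    then have i: "i \<in> {1..n}" by blast
    show ?case
    proof (intro ballI impI)
      fix x assume x: "x \<in> {1..n} \<rightarrow>\<^sub>E V"
        and x': "\<forall>l\<in>{1..n}. x l \<in> (if l \<in> insert i J then span B else B)"
      have lin: "N (x(i := c *\<^sub>R f + d *\<^sub>R g)) = c * N (x(i := f)) + d * N (x(i := g))"
        if "multilinear_on n V N" "f \<in> V" "g \<in> V" for N c d f g
        using x i that unfolding multilinear_on_def by blast
      have "x i \<in> span B" using bspec[OF x' i] by simp
      then have "x i \<in> V \<and> M (x(i := x i)) = M' (x(i := x i))"
      proof (rule span_induct)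
        \<comment> \<open>Membership in \<open>V\<close> is built into the subspace because
          linearity is available only for vectors of \<open>V\<close>.\<close>
        show "subspace {f. f \<in> V \<and> M (x(i := f)) = M' (x(i := f))}"
        proof (rule subspaceI; clarify)
          show "0 \<in> V \<and> M (x(i := 0)) = M' (x(i := 0))"
            using lin[OF M, of 0 0 0 0] lin[OF M', of 0 0 0 0] subspace_0[OF V] by simp
          show "f + g \<in> V \<and> M (x(i := f + g)) = M' (x(i := f + g))"
            if "f \<in> V" "M (x(i := f)) = M' (x(i := f))" "g \<in> V" "M (x(i := g)) = M' (x(i := g))" for f g
            using lin[OF M, of f g 1 1] lin[OF M', of f g 1 1] that subspace_add[OF V] by simp
          show "c *\<^sub>R f \<in> V \<and> M (x(i := c *\<^sub>R f)) = M' (x(i := c *\<^sub>R f))"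
            if "f \<in> V" "M (x(i := f)) = M' (x(i := f))" for c f
            using lin[OF M, of f f c 0] lin[OF M', of f f c 0] that subspace_scale[OF V] by simp
        qed
        fix f assume f: "f \<in> B"
        have mem: "x(i := f) \<in> {1..n} \<rightarrow>\<^sub>E V"
          using x i f B by (auto simp: PiE_iff extensional_def)
        have mem': "\<forall>l\<in>{1..n}. (x(i := f)) l \<in> (if l \<in> J then span B else B)"
          using x' f insert.hyps(2) by (auto split: if_splits)
        have "J \<subseteq> {1..n}" using insert.prems by simp
        then have "M (x(i := f)) = M' (x(i := f))"
          by (rule mp[OF bspec[OF insert.IH mem] mem'])
        then show "f \<in> V \<and> M (x(i := f)) = M' (x(i := f))"
          using subsetD[OF B f] by simp
      qed
      then show "M x = M' x" by simp
    qed
  qed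
  from this[of "{1..n}"]
  have all: "\<forall>x\<in>{1..n} \<rightarrow>\<^sub>E V. (\<forall>l\<in>{1..n}. x l \<in> (if l \<in> {1..n} then span B else B)) \<longrightarrow> M x = M' x"
    by simp
  have xV: "x \<in> {1..n} \<rightarrow>\<^sub>E V" using x BV by (auto simp: PiE_iff)
  have "\<forall>l\<in>{1..n}. x l \<in> (if l \<in> {1..n} then span B else B)"
    using PiE_mem[OF x] by simp
  then show ?thesis by (rule mp[OF bspec[OF all xV]])
qed

section \<open>Values of invariant functionals on cell indicators\<close>

lemma functionals_ext:
  assumes "\<Lambda> \<in> functionals n"
  obtains M where "multilinear_on n (span graphons) M" "\<And>g. g \<in> {1..n} \<rightarrow>\<^sub>E graphons \<Longrightarrow> M g = \<Lambda> g"
proof -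
  have "\<exists>M. multilinear_on n (span graphons) M \<and> (\<forall>g\<in>{1..n} \<rightarrow>\<^sub>E graphons. M g = \<Lambda> g)"
    using assms by (simp only: functionals_def mem_Collect_eq)
  then show ?thesis by (elim exE conjE) (rule that, assumption, erule bspec)
qed

lemma functionals_permute:
  assumes "\<Lambda> \<in> functionals n" "g \<in> {1..n} \<rightarrow>\<^sub>E graphons" "\<tau> permutes {1..n}"
  shows "\<Lambda> (g \<circ> \<tau>) = \<Lambda> g"
  using assms by (simp add: functionals_def)

lemma functionals_act:
  assumes "\<Lambda> \<in> functionals n" "g \<in> {1..n} \<rightarrow>\<^sub>E graphons" "\<sigma> \<in> mp_bijections"
  shows "\<Lambda> (act_tuple n \<sigma> g) = \<Lambda> g"
  using assms by (simp add: functionals_def)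

lemma e_tuple_graphons:
  assumes p: "p \<ge> 1" and ab: "ab \<in> {1..n} \<rightarrow> vertex_pairs p"
  shows "e_tuple n p ab \<in> {1..n} \<rightarrow>\<^sub>E graphons"
  unfolding e_tuple_def restrict_PiE_iff
proof
  fix l assume "l \<in> {1..n}"
  then have "ab l \<in> vertex_pairs p" using ab by blast
  then show "ep p (ab l) \<in> graphons" using ep_graphon[OF p] by (cases "ab l") auto
qed

lemma functional_isomorphic:
  assumes \<Lambda>: "\<Lambda> \<in> functionals n" and p: "p \<ge> 1"
    and ab: "ab \<in> {1..n} \<rightarrow> vertex_pairs p" and cd: "cd \<in> {1..n} \<rightarrow> vertex_pairs p"
    and iso: "isomorphic (\<Gamma> n p ab) (\<Gamma> n p cd)"
  shows "\<Lambda> (e_tuple n p ab) = \<Lambda> (e_tuple n p cd)"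
proof -
  obtain \<phi> \<psi> where \<phi>: "bij_betw \<phi> {1..p} {1..p}" and \<psi>: "bij_betw \<psi> {1..n} {1..n}"
    and e: "\<And>l. l \<in> {1..n} \<Longrightarrow> {fst (cd (\<psi> l)), snd (cd (\<psi> l))} = {\<phi> (fst (ab l)), \<phi> (snd (ab l))}"
    using iso unfolding isomorphic_def multigraph_map_def by auto
  \<comment> \<open>\<open>permutes\<close> asks for the identity outside \<open>{1..n}\<close>,
    where nothing is known about \<open>\<psi>\<close>.\<close>
  define \<tau> where "\<tau> l = (if l \<in> {1..n} then \<psi> l else l)" for l
  have "bij_betw \<tau> {1..n} {1..n}"
    using \<psi> by (rule bij_betw_cong[THEN iffD1, rotated]) (simp add: \<tau>_def)
  then have \<tau>: "\<tau> permutes {1..n}" by (rule bij_imp_permutes) (simp only: \<tau>_def if_False)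
  have \<psi>_mem: "\<psi> l \<in> {1..n}" if "l \<in> {1..n}" for l using \<psi> that by (auto dest: bij_betwE)
  let ?h = "e_tuple n p cd \<circ> \<tau>" and ?\<sigma> = "cell_exchange p \<phi>"
  have h: "?h l = ep p (\<phi> (fst (ab l)), \<phi> (snd (ab l)))" if l: "l \<in> {1..n}" for l
  proof -
    obtain c d where c: "cd (\<psi> l) = (c, d)" by fastforce
    then have "?h l = ep p (c, d)" using l \<psi>_mem[OF l] by (simp add: e_tuple_def \<tau>_def)
    \<comment> \<open>Endpoints match only as unordered pairs; \<open>ep_commute\<close> makes up
      for the order.\<close>
    moreover have "(c, d) = (\<phi> (fst (ab l)), \<phi> (snd (ab l))) \<or> (d, c) = (\<phi> (fst (ab l)), \<phi> (snd (ab l)))"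
      using e[OF l] c by (auto simp: doubleton_eq_iff)
    ultimately show ?thesis using ep_commute[of p c d] by auto
  qed
  have cd_g: "e_tuple n p cd \<in> {1..n} \<rightarrow>\<^sub>E graphons" by (rule e_tuple_graphons[OF p cd])
  have h_g: "?h \<in> {1..n} \<rightarrow>\<^sub>E graphons"
  proof (rule PiE_I)
    show "?h l \<in> graphons" if "l \<in> {1..n}" for l
      using PiE_mem[OF cd_g] permutes_in_image[OF \<tau>] that by simp
    show "?h l = undefined" if "l \<notin> {1..n}" for l
      using PiE_arb[OF cd_g that] that by (simp only: comp_def \<tau>_def if_False)
  qed
  have "act_tuple n ?\<sigma> ?h = e_tuple n p ab"
    unfolding act_tuple_def e_tuple_def[of n p ab]
  proof (rule restrict_ext)
    fix l assume l: "l \<in> {1..n}"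
    then have "(fst (ab l), snd (ab l)) \<in> vertex_pairs p" using ab by auto
    from act_cell_exchange_ep[OF p \<phi> this] show "act ?\<sigma> (?h l) = ep p (ab l)"
      unfolding h[OF l] by simp
  qed
  then have "\<Lambda> (e_tuple n p ab) = \<Lambda> ?h"
    using functionals_act[OF \<Lambda> h_g cell_exchange_mp[OF p \<phi>]] by simp
  also have "\<dots> = \<Lambda> (e_tuple n p cd)" by (rule functionals_permute[OF \<Lambda> cd_g \<tau>])
  finally show ?thesis .
qed

text \<open>Evaluates the definite description in \<open>Cnp\<close>: tuples with isomorphic graphs
  have equal values by \<open>functional_isomorphic\<close>, and \<open>ab\<close> is itself a
  candidate, which settles uniqueness.\<close>

lemma Cnp_\<Gamma>_class:
  assumes \<Lambda>: "\<Lambda> \<in> functionals n" and p: "p \<ge> 1" and ab: "ab \<in> index_tuples n p"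
  shows "Cnp n p \<Lambda> (\<Gamma>_class n p ab) = \<Lambda> (e_tuple n p ab)"
proof -
  have abPi: "ab \<in> {1..n} \<rightarrow> vertex_pairs p" using ab by (simp add: index_tuples_alt PiE_def)
  have "(THE v. \<forall>cd\<in>index_tuples n p. \<Gamma> n p cd \<in> \<Gamma>_class n p ab \<longrightarrow> v = \<Lambda> (e_tuple n p cd)) =
      \<Lambda> (e_tuple n p ab)"
  proof (rule the_equality)
    show "\<forall>cd\<in>index_tuples n p. \<Gamma> n p cd \<in> \<Gamma>_class n p ab \<longrightarrow> \<Lambda> (e_tuple n p ab) = \<Lambda> (e_tuple n p cd)"
    proof (intro ballI impI)
      fix cd assume cd: "cd \<in> index_tuples n p" "\<Gamma> n p cd \<in> \<Gamma>_class n p ab"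
      then have "cd \<in> {1..n} \<rightarrow> vertex_pairs p" "isomorphic (\<Gamma> n p ab) (\<Gamma> n p cd)"
        by (simp_all add: index_tuples_alt PiE_def \<Gamma>_class_def iso_class_def)
      then show "\<Lambda> (e_tuple n p ab) = \<Lambda> (e_tuple n p cd)"
        by (rule functional_isomorphic[OF \<Lambda> p abPi])
    qed
    have "\<Gamma> n p ab \<in> \<Gamma>_class n p ab"
      unfolding \<Gamma>_class_def by (rule iso_class_self[OF is_multigraph_\<Gamma>[OF abPi]])
    then show "v = \<Lambda> (e_tuple n p ab)"
      if "\<forall>cd\<in>index_tuples n p. \<Gamma> n p cd \<in> \<Gamma>_class n p ab \<longrightarrow> v = \<Lambda> (e_tuple n p cd)" for v
      using that ab by blast
  qed
  then show ?thesis using \<Gamma>_class_in_Hnp[OF abPi] by (simp add: Cnp_def)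
qed

lemma Cnp_in_Xnp: "Cnp n p \<Lambda> \<in> Xnp n p"
  by (simp add: Cnp_def Xnp_def)

text \<open>Each cell indicator is a sum of indicators on the finer grid, and all n arguments are
  expanded. This is done for the extension \<open>M\<close>, which carries the multilinearity; every
  resulting term is a tuple of graphons, where \<open>M\<close> agrees with
  \<open>\<Lambda>\<close>.\<close>

lemma functional_refine:
  assumes \<Lambda>: "\<Lambda> \<in> functionals n" and p: "p \<ge> 1" and k: "k \<ge> 1" and ab: "ab \<in> {1..n} \<rightarrow> vertex_pairs p"
  shows "\<Lambda> (e_tuple n p ab) = (\<Sum>ij\<in>shifts n k. \<Lambda> (e_tuple n (k * p) (refine k ab ij)))"
proof -
  obtain M where M: "multilinear_on n (span graphons) M" "\<And>g. g \<in> {1..n} \<rightarrow>\<^sub>E graphons \<Longrightarrow> M g = \<Lambda> g"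
    using functionals_ext[OF \<Lambda>] by blast
  have kp: "k * p \<ge> 1" using mult_le_mono[OF k p] by simp
  let ?S = "{1..k} \<times> {1..k}"
  define f where "f l s = ep (k * p) (subcell k (fst (ab l)) (fst s), subcell k (snd (ab l)) (snd s))" for l s
  have ab1: "fst (ab l) \<in> {1..p}" "snd (ab l) \<in> {1..p}" "fst (ab l) \<noteq> snd (ab l)" if "l \<in> {1..n}" for l
    using ab that by (auto simp: vertex_pairs_def Pi_def split_def)
  have f_graphon: "f l s \<in> graphons" if "l \<in> {1..n}" "s \<in> ?S" for l s
    unfolding f_def
  proof (intro ep_graphon[OF kp] subcell_pair_mem)
    show "(fst (ab l), snd (ab l)) \<in> vertex_pairs p" using ab that(1) by auto
  qed (use that(2) in \<open>auto simp: mem_Times_iff\<close>)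
  have e: "e_tuple n p ab = (\<lambda>l\<in>{1..n}. \<Sum>s\<in>?S. f l s)"
    unfolding e_tuple_def
  proof (rule restrict_ext)
    fix l assume l: "l \<in> {1..n}"
    show "ep p (ab l) = (\<Sum>s\<in>?S. f l s)"
      using ep_subcells[OF p k, of "fst (ab l)" "snd (ab l)"] ab1[OF l] by (simp add: f_def)
  qed
  have "\<Lambda> (e_tuple n p ab) = M (\<lambda>l\<in>{1..n}. \<Sum>s\<in>?S. f l s)"
    using M(2)[OF e_tuple_graphons[OF p ab]] by (simp add: e)
  also have "\<dots> = (\<Sum>t\<in>{1..n} \<rightarrow>\<^sub>E ?S. M (\<lambda>l\<in>{1..n}. f l (t l)))"
    by (rule multilinear_on_sum_all[OF M(1) subspace_span]) (simp, rule span_base, rule f_graphon)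
  also have "\<dots> = (\<Sum>ij\<in>shifts n k. \<Lambda> (e_tuple n (k * p) (refine k ab ij)))"
    unfolding shifts_def
  proof (rule sum.cong[OF refl])
    fix t assume t: "t \<in> {1..n} \<rightarrow>\<^sub>E ?S"
    have "(\<lambda>l\<in>{1..n}. f l (t l)) = e_tuple n (k * p) (refine k ab t)"
      by (simp add: e_tuple_def f_def refine_alt cong: restrict_cong)
    then show "M (\<lambda>l\<in>{1..n}. f l (t l)) = \<Lambda> (e_tuple n (k * p) (refine k ab t))"
      using M(2)[OF e_tuple_graphons[OF kp refine_mem[OF ab]]] t by (simp add: shifts_def)
  qed
  finally show ?thesis .
qed

lemma consistency_Cnp:
  assumes \<Lambda>: "\<Lambda> \<in> functionals n" and p: "p \<ge> 2" and k: "k \<ge> 1"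
  shows "consistency n k p (Cnp n (k * p) \<Lambda>) = Cnp n p \<Lambda>"
proof
  fix g show "consistency n k p (Cnp n (k * p) \<Lambda>) g = Cnp n p \<Lambda> g"
  proof (cases "g \<in> Hnp n p")
    case False
    then show ?thesis by (simp add: consistency_def Cnp_def)
  next
    case True
    then obtain ab where ab: "ab \<in> index_tuples n p" and g: "g = \<Gamma>_class n p ab"
      unfolding Hnp_alt by blast
    then have abPi: "ab \<in> {1..n} \<rightarrow> vertex_pairs p" by (simp add: index_tuples_alt PiE_def)
    have p1: "p \<ge> 1" using p by simp
    have kp: "k * p \<ge> 1" using mult_le_mono[OF k p1] by simp
    have "Cnp n (k * p) \<Lambda> (\<Gamma>_class n (k * p) (refine k ab ij)) = \<Lambda> (e_tuple n (k * p) (refine k ab ij))"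
      if ij: "ij \<in> shifts n k" for ij
    proof -
      let ?cd = "restrict (refine k ab ij) {1..n}"
      have "?cd \<in> index_tuples n (k * p)"
        unfolding index_tuples_alt restrict_PiE_iff using refine_mem[OF abPi ij] by blast
      from Cnp_\<Gamma>_class[OF \<Lambda> kp this]
      have "Cnp n (k * p) \<Lambda> (\<Gamma>_class n (k * p) ?cd) = \<Lambda> (e_tuple n (k * p) ?cd)" .
      moreover have "\<Gamma>_class n (k * p) ?cd = \<Gamma>_class n (k * p) (refine k ab ij)"
        by (rule \<Gamma>_class_cong[OF refine_mem[OF abPi ij]]) simp
      moreover have "e_tuple n (k * p) ?cd = e_tuple n (k * p) (refine k ab ij)"
        by (simp add: e_tuple_def cong: restrict_cong)
      ultimately show ?thesis by simp
    qed
    then show ?thesis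
      using Cnp_\<Gamma>_class[OF \<Lambda> p1 ab] functional_refine[OF \<Lambda> p1 k abPi]
      by (simp add: g consistency_\<Gamma>_class[OF p abPi])
  qed
qed

section \<open>From cell indicators to all step functions\<close>

lemma span_Ep_mono:
  assumes p: "p \<ge> 1" and k: "k \<ge> 1"
  shows "span (Ep p) \<subseteq> span (Ep (k * p))"
proof (rule span_minimal[OF _ subspace_span], unfold Ep_alt, rule image_subsetI, clarify)
  fix a b assume ab': "(a, b) \<in> vertex_pairs p"
  then have ab: "a \<ge> 1" "b \<ge> 1" by (simp_all add: vertex_pairs_def)
  have "ep (k * p) (subcell k a (fst s), subcell k b (snd s)) \<in> span (ep (k * p) ` vertex_pairs (k * p))"
    if "s \<in> {1..k} \<times> {1..k}" for s
    using that by (intro span_base imageI subcell_pair_mem[OF ab']) (auto simp: mem_Times_iff)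
  then show "ep p (a, b) \<in> span (ep (k * p) ` vertex_pairs (k * p))"
    unfolding ep_subcells[OF p k ab] by (rule span_sum)
qed

text \<open>On tuples from \<open>Ep p\<close> the values are components of \<open>Cnp\<close>, and
  agreement there spreads to the span through the multilinear extensions. That \<open>g\<close> also
  consists of graphons allows the return from \<open>M\<close> to \<open>\<Lambda>\<close>.\<close>

lemma functional_eqI_Cnp:
  assumes \<Lambda>: "\<Lambda> \<in> functionals n" and \<Lambda>': "\<Lambda>' \<in> functionals n" and p: "p \<ge> 1"
    and eq: "Cnp n p \<Lambda> = Cnp n p \<Lambda>'"
    and g: "g \<in> {1..n} \<rightarrow>\<^sub>E graphons" "g \<in> {1..n} \<rightarrow>\<^sub>E span (Ep p)"
  shows "\<Lambda> g = \<Lambda>' g"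
proof -
  obtain M where M: "multilinear_on n (span graphons) M" "\<And>g. g \<in> {1..n} \<rightarrow>\<^sub>E graphons \<Longrightarrow> M g = \<Lambda> g"
    using functionals_ext[OF \<Lambda>] by blast
  obtain M' where M': "multilinear_on n (span graphons) M'" "\<And>g. g \<in> {1..n} \<rightarrow>\<^sub>E graphons \<Longrightarrow> M' g = \<Lambda>' g"
    using functionals_ext[OF \<Lambda>'] by blast
  have Ep: "Ep p \<subseteq> graphons" unfolding Ep_alt using ep_graphon[OF p] by auto
  have "M g = M' g"
  proof (rule multilinear_on_span_eqI[OF M(1) M'(1) subspace_span _ _ g(2)])
    show "Ep p \<subseteq> span graphons" using Ep span_superset by (rule order_trans)
    fix x assume x: "x \<in> {1..n} \<rightarrow>\<^sub>E Ep p"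
    then have "\<forall>l\<in>{1..n}. \<exists>ab. ab \<in> vertex_pairs p \<and> x l = ep p ab"
      unfolding Ep_alt by (fastforce dest: PiE_mem)
    then obtain ab where ab: "\<forall>l\<in>{1..n}. ab l \<in> vertex_pairs p \<and> x l = ep p (ab l)"
      unfolding bchoice_iff by blast
    let ?ab = "restrict ab {1..n}"
    have ab': "?ab \<in> index_tuples n p" unfolding index_tuples_alt restrict_PiE_iff using ab by blast
    have x_eq: "x = e_tuple n p ?ab"
    proof
      fix l show "x l = e_tuple n p ?ab l"
        using ab PiE_arb[OF x, of l] by (cases "l \<in> {1..n}") (simp_all add: e_tuple_def del: atLeastAtMost_iff)
    qed
    have "x \<in> {1..n} \<rightarrow>\<^sub>E graphons" using x Ep by (auto simp: PiE_iff)
    then show "M x = M' x"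
      using M(2) M'(2) Cnp_\<Gamma>_class[OF \<Lambda> p ab'] Cnp_\<Gamma>_class[OF \<Lambda>' p ab'] eq by (simp add: x_eq)
  qed
  then show ?thesis using M(2) M'(2) g(1) by simp
qed

lemma Wstep_subset_graphons: "Wstep \<subseteq> graphons"
  by (auto simp: Wstep_def Wp_def)

text \<open>Stated for all multiples \<open>k * p\<close>, so that one \<open>k\<close> depending
  only on \<open>g\<close> can later be combined with the given \<open>p0\<close>.\<close>

lemma Wstep_common_refinement:
  fixes n :: nat
  assumes g: "g \<in> {1..n} \<rightarrow>\<^sub>E Wstep"
  obtains k where "k \<ge> 1" "\<And>p. p \<ge> 1 \<Longrightarrow> g \<in> {1..n} \<rightarrow>\<^sub>E span (Ep (k * p))"
proof -
  have "\<forall>l\<in>{1..n}. \<exists>q. q \<ge> 1 \<and> g l \<in> span (Ep q)"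
    using PiE_mem[OF g] by (fastforce simp: Wstep_def Wp_def)
  then obtain q where q: "\<forall>l\<in>{1..n}. q l \<ge> 1 \<and> g l \<in> span (Ep (q l))"
    unfolding bchoice_iff by blast
  \<comment> \<open>The product of the grid sizes is a common multiple of them, and so is
    \<open>k * p\<close>.\<close>
  define k where "k = (\<Prod>l\<in>{1..n}. q l)"
  have k: "k \<ge> 1" unfolding k_def using q by (intro prod_ge_1) auto
  have "g \<in> {1..n} \<rightarrow>\<^sub>E span (Ep (k * p))" if p: "p \<ge> 1" for p
  proof (rule PiE_I)
    fix l assume l: "l \<in> {1..n}"
    have "q l dvd k * p" unfolding k_def by (rule dvd_mult2, rule dvd_prodI) (use l in simp_all)
    then obtain m where m: "k * p = m * q l" by (metis dvdE mult.commute)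
    then have "m \<ge> 1" using k p by (cases m) auto
    then show "g l \<in> span (Ep (k * p))"
      using span_Ep_mono[of "q l" m] q l unfolding m by blast
  qed (rule PiE_arb[OF g])
  with k show ?thesis by (rule that)
qed

theorem theorem3p15:
  fixes n k :: nat
  assumes "n \<ge> 1" and "k \<ge> 1"
  shows "(partial_order_on (Hn n) (surj_order n) \<and>
          (\<forall>g\<in>Hn n. \<forall>h\<in>Hn n. \<pi> n k g h \<noteq> 0 \<longrightarrow> (g, h) \<in> surj_order n) \<and>
          (\<forall>g\<in>Hn n. \<pi> n k g g > 0))
       \<and> ((\<forall>p\<ge>2. consistency n k p ` Xnp n (k * p) = Xnp n p) \<and>
          (\<forall>p\<ge>2. p \<ge> 2 * n \<longrightarrow> bij_betw (consistency n k p) (Xnp n (k * p)) (Xnp n p)) \<and>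
          (\<forall>k1\<ge>1. \<forall>k2\<ge>1. \<forall>p\<ge>2. \<forall>A\<in>Xnp n (k1 * k2 * p).
             consistency n (k1 * k2) p A =
             (consistency n k2 p \<circ> consistency n k1 (k2 * p)) A))
       \<and> (finite (Hn n) \<and> subspace (LC n) \<and> dim (LC n) = card (Hn n))
       \<and> (\<forall>p0 \<ge> 2 * n. card (Hnp n p0) = card (Hn n) \<and>
          (\<forall>\<Lambda>\<in>functionals n. \<forall>\<Lambda>'\<in>functionals n. Cnp n p0 \<Lambda> = Cnp n p0 \<Lambda>' \<longrightarrow>
             (\<forall>\<sigma>\<in>mp_bijections. \<forall>g\<in>{1..n} \<rightarrow>\<^sub>E Wstep.
                \<Lambda> (act_tuple n \<sigma> g) = \<Lambda>' (act_tuple n \<sigma> g))))"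
proof (intro conjI allI ballI impI)
  show "partial_order_on (Hn n) (surj_order n)" by (rule partial_order_surj_order)
  show "(g, h) \<in> surj_order n" if "g \<in> Hn n" "h \<in> Hn n" "\<pi> n k g h \<noteq> 0" for g h
    by (rule \<pi>_nonzero_imp_surj_order[OF assms(1) that])
  show "\<pi> n k g g > 0" if "g \<in> Hn n" for g
    by (rule \<pi>_diag_pos[OF assms that])
  show "consistency n k p ` Xnp n (k * p) = Xnp n p" if "p \<ge> 2" for p
    by (rule consistency_surj[OF assms])
  show "bij_betw (consistency n k p) (Xnp n (k * p)) (Xnp n p)" if "p \<ge> 2" "p \<ge> 2 * n" for p
    by (rule consistency_bij[OF assms that(2)])
  show "consistency n (k1 * k2) p A = (consistency n k2 p \<circ> consistency n k1 (k2 * p)) A"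
    if "k1 \<ge> 1" "k2 \<ge> 1" "p \<ge> 2" for k1 k2 p A
    unfolding comp_def by (rule consistency_comp[OF that(3,2)])
  show "finite (Hn n)" by (rule finite_Hn)
  show "subspace (LC n)" by (rule subspace_LC)
  show "dim (LC n) = card (Hn n)" by (rule dim_LC[OF assms(1)])
next
  fix p0 assume p0: "p0 \<ge> 2 * n"
  then show "card (Hnp n p0) = card (Hn n)" by (rule card_Hnp)
  fix \<Lambda> \<Lambda>' \<sigma> g
  assume \<Lambda>: "\<Lambda> \<in> functionals n" "\<Lambda>' \<in> functionals n" and eq: "Cnp n p0 \<Lambda> = Cnp n p0 \<Lambda>'"
    and \<sigma>: "\<sigma> \<in> mp_bijections" and g: "g \<in> {1..n} \<rightarrow>\<^sub>E Wstep"
  have p0_2: "p0 \<ge> 2" and p0_1: "p0 \<ge> 1" using p0 assms(1) by simp_all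
  obtain m where m: "m \<ge> 1" "\<And>p. p \<ge> 1 \<Longrightarrow> g \<in> {1..n} \<rightarrow>\<^sub>E span (Ep (m * p))"
    using Wstep_common_refinement[OF g] by blast
  \<comment> \<open>Equality of the components climbs to the finer grid: both vectors have the same
    image at level \<open>p0\<close>, and the map down is injective since p0 \<ge> 2n.\<close>
  have "Cnp n (m * p0) \<Lambda> = Cnp n (m * p0) \<Lambda>'"
  proof (rule inj_onD[OF consistency_inj[OF assms(1) m(1) p0] _ Cnp_in_Xnp Cnp_in_Xnp])
    show "consistency n m p0 (Cnp n (m * p0) \<Lambda>) = consistency n m p0 (Cnp n (m * p0) \<Lambda>')"
      by (simp only: consistency_Cnp[OF \<Lambda>(1) p0_2 m(1)] consistency_Cnp[OF \<Lambda>(2) p0_2 m(1)] eq)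
  qed
  moreover have g': "g \<in> {1..n} \<rightarrow>\<^sub>E graphons"
    using g Wstep_subset_graphons by (auto simp: PiE_iff)
  moreover have "m * p0 \<ge> 1" using mult_le_mono[OF m(1) p0_1] by simp
  ultimately have "\<Lambda> g = \<Lambda>' g"
    using functional_eqI_Cnp[OF \<Lambda>] m(2)[OF p0_1] by blast
  \<comment> \<open>Invariance removes \<open>\<sigma>\<close> on both sides, so agreement at
    \<open>g\<close> is enough.\<close>
  then show "\<Lambda> (act_tuple n \<sigma> g) = \<Lambda>' (act_tuple n \<sigma> g)"
    by (simp only: functionals_act[OF \<Lambda>(1) g' \<sigma>] functionals_act[OF \<Lambda>(2) g' \<sigma>])
qed

end
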